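(* Let $d\ge 1$ and $k\ge 1$ be fixed. For every fixed integer $j\ge 2$, $$F(n,j,k,d)=\Theta(n^{d-1})\qquad (n\to\infty).$$
   Context: A $d$-dimensional $n_1\times\cdots\times n_d$ zero-one matrix is an array $A=(a_{i_1,\ldots,i_d})$, $1\le i_\ell\le n_\ell$, with entries in $\{0,1\}$. A submatrix is obtained by selecting, for each $\ell$, a set of values of the $\ell$-th coordinate (keeping the order). $A$ contains a $d$-dimensional zero-one matrix $B$ if some submatrix of $A$ can be transformed into $B$ by changing any number of ones to zeros; otherwise $A$ avoids $B$. $f(n,B,d)$ denotes the maximum number of ones in a $d$-dimensional $n\times\cdots\times n$ zero-one matrix that avoids $B$. An $\ell$-cross section is the set of all entries having a fixed value of the $\ell$-th coordinate. A $d$-dimensional $k\times\cdots\times k$ zero-one matrix is a permutation matrix if each of its $\ell$-cross sections contains exactly one nonzero entry, for every $\ell=1,\ldots,d$. $R^{k_1,\ldots,k_d}$ is the $k_1\times\cdots\times k_d$ matrix of all ones, and the Kronecker product $M\otimes N$ is obtained by replacing each $1$-entry of $M$ by a copy of $N$ and each $0$-entry of $M$ by a zero matrix of the same size as $N$. For a permutation matrix $P$, the matrix $P\otimes R^{k_1,\ldots,k_d}$ is called a $j$-tuple permutation matrix generated by $P$ if one of $k_1,\ldots,k_d$ equals $j$ and the rest equal $1$. Define $F(n,j,k,d)=\max_M f(n,M,d)$, where $M$ ranges over all $d$-dimensional $j$-tuple permutation matrices generated by $d$-dimensional $k\times\cdots\times k$ permutation matrices. Implied constants may depend on $d,j,k$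 but not on $n$. *)

theory Defs
  imports "HOL-Library.Landau_Symbols" "HOL-Library.FuncSet"
begin

(* A multidimensional array is given by its list of side lengths [n_1,...,n_d] and its entries;
   the dimension d is the length of that list. Index tuples are lists, and coordinates as well as
   coordinate positions are counted from 0, so the l-th coordinate runs through {..<n_l}. *)
datatype multi_array = Array (dims: "nat list") (entry: "nat list \<Rightarrow> nat")

definition indices :: "nat list \<Rightarrow> nat list set" where
  "indices ns = {x. length x = length ns \<and> (\<forall>l<length ns. x ! l < ns ! l)}"

(* Entries outside the index set are fixed to be undefined, so that equality of zero-one matrices
   is equality of side lengths and entries. *)
definition zero_one_matrix :: "multi_array \<Rightarrow> bool" where
  "zero_one_matrix A \<longleftrightarrow> entry A \<in> indices (dims A) \<rightarrow>\<^sub>E {0, 1}"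

(* Ss ! l is the set of selected values of the l-th coordinate; its elements keep their order. *)
definition submatrix :: "multi_array \<Rightarrow> nat set list \<Rightarrow> multi_array" where
  "submatrix A Ss = Array (map card Ss)
     (\<lambda>x\<in>indices (map card Ss). entry A (map2 (\<lambda>S i. sorted_list_of_set S ! i) Ss x))"

definition is_submatrix_of :: "multi_array \<Rightarrow> multi_array \<Rightarrow> bool" where
  "is_submatrix_of C A \<longleftrightarrow>
     (\<exists>Ss. length Ss = length (dims A) \<and> (\<forall>l<length Ss. Ss ! l \<subseteq> {..<dims A ! l}) \<and>
        C = submatrix A Ss)"

definition contains :: "multi_array \<Rightarrow> multi_array \<Rightarrow> bool" where
  "contains A B \<longleftrightarrow>
     (\<exists>C. is_submatrix_of C A \<and> dims C = dims B \<and>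
        (\<forall>x\<in>indices (dims B). entry B x = entry C x \<or> entry C x = 1 \<and> entry B x = 0))"

definition num_ones :: "multi_array \<Rightarrow> nat" where
  "num_ones A = card {x \<in> indices (dims A). entry A x = 1}"

(* The function f(n,B,d). The maximum is over a finite set, which is nonempty as soon as B has
   a 1-entry, because the zero matrix then avoids B. *)
definition ex_ones :: "nat \<Rightarrow> multi_array \<Rightarrow> nat \<Rightarrow> nat" where
  "ex_ones n B d =
     Max (num_ones ` {A. zero_one_matrix A \<and> dims A = replicate d n \<and> \<not> contains A B})"

definition cross_section :: "multi_array \<Rightarrow> nat \<Rightarrow> nat \<Rightarrow> nat list set" where
  "cross_section A l c = {x \<in> indices (dims A). x ! l = c}"

definition permutation_matrix :: "nat \<Rightarrow> nat \<Rightarrow> multi_array \<Rightarrow> bool" where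
  "permutation_matrix d k P \<longleftrightarrow>
     zero_one_matrix P \<and> dims P = replicate d k \<and>
     (\<forall>l<d. \<forall>c<k. \<exists>!x. x \<in> cross_section P l c \<and> entry P x \<noteq> 0)"

definition all_ones :: "nat list \<Rightarrow> multi_array" where
  "all_ones ks = Array ks (\<lambda>x\<in>indices ks. 1)"

(* For an index x of the product, the coordinatewise quotients by the side lengths of N locate the
   block containing x, and the coordinatewise remainders locate x inside that block. *)
definition kronecker :: "multi_array \<Rightarrow> multi_array \<Rightarrow> multi_array" where
  "kronecker M N = Array (map2 (*) (dims M) (dims N))
     (\<lambda>x\<in>indices (map2 (*) (dims M) (dims N)).
        if entry M (map2 (div) x (dims N)) = 1 then entry N (map2 (mod) x (dims N)) else 0)"

definition tuple_permutation_matrices :: "nat \<Rightarrow> nat \<Rightarrow> nat \<Rightarrow> multi_array set" where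
  "tuple_permutation_matrices j k d =
     {kronecker P (all_ones ((replicate d 1)[l := j])) | P l. permutation_matrix d k P \<and> l < d}"

(* The function F(n,j,k,d). For d, k >= 1 the maximum is over a finite nonempty set. *)
definition ex_tuple_permutation :: "nat \<Rightarrow> nat \<Rightarrow> nat \<Rightarrow> nat \<Rightarrow> nat" where
  "ex_tuple_permutation n j k d =
     Max ((\<lambda>M. ex_ones n M d) ` tuple_permutation_matrices j k d)"

end

theory Submission
  imports Defs
begin

text \<open>
  Lower bound: in an all-ones cross section any two ones agree in coordinate \<open>l\<close>, whereas the
  pattern has ones with different \<open>l\<close>-th coordinates.

  Upper bound: a Marcus-Tardos argument, by induction on the dimension. Cut the matrix into cubes of
  side \<open>s\<close>. Cubes in which some line in direction \<open>l\<close> has at least \<open>j * k\<close> ones are few: for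
  a fixed cross section and fixed positions of these ones they avoid the pattern with coordinate
  \<open>l\<close> deleted. Contracting the remaining cubes to single ones does not work for \<open>j\<close>-tuples, since
  \<open>j\<close> ones in consecutive cubes need not lie on a line. Instead one scans each row of cubes in
  direction \<open>l\<close> and closes a chunk once some line has \<open>j\<close> ones in it. The starting cubes of the
  chunks avoid the pattern. A chunk with ones at \<open>k\<close> different values of some coordinate
  \<open>i \<noteq> l\<close> is called wide, and wide chunks are few by the induction hypothesis for coordinate \<open>i\<close>
  deleted. Every other chunk has at most \<open>2 * j * k ^ d\<close> ones, a bound that does not depend
  on \<open>s\<close>, so a large \<open>s\<close> makes the recursion on the side length close.
\<close>

subsection \<open>Patterns in point sets\<close>

text \<open>
  A pattern is coded by rankings: \<open>\<pi> i t\<close> is the \<open>i\<close>-th coordinate of the \<open>t\<close>-th one of the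
  permutation matrix, and only the implied order relations are demanded of a copy. Deleting
  coordinate \<open>i\<close> from the pattern is then just deleting \<open>i\<close> from \<open>D\<close>.
\<close>

definition line :: "nat set \<Rightarrow> nat \<Rightarrow> (nat \<Rightarrow> nat) set \<Rightarrow> (nat \<Rightarrow> nat) \<Rightarrow> nat set" where
  "line D l X u = {x l | x. x \<in> X \<and> (\<forall>i\<in>D - {l}. x i = u i)}"

definition pattern_at :: "nat set \<Rightarrow> nat \<Rightarrow> nat \<Rightarrow> nat \<Rightarrow> (nat \<Rightarrow> nat \<Rightarrow> nat) \<Rightarrow> (nat \<Rightarrow> nat) set \<Rightarrow>
    (nat \<Rightarrow> nat \<Rightarrow> nat) \<Rightarrow> (nat \<Rightarrow> nat set) \<Rightarrow> bool" where
  "pattern_at D l j k \<pi> X u T \<longleftrightarrow>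
     (\<forall>t<k. T t \<subseteq> line D l X (u t) \<and> card (T t) = j) \<and>
     (\<forall>i\<in>D - {l}. \<forall>t<k. \<forall>t'<k. \<pi> i t < \<pi> i t' \<longrightarrow> u t i < u t' i) \<and>
     (\<forall>t<k. \<forall>t'<k. \<pi> l t < \<pi> l t' \<longrightarrow> (\<forall>v\<in>T t. \<forall>v'\<in>T t'. v < v'))"

definition has_pattern ::
    "nat set \<Rightarrow> nat \<Rightarrow> nat \<Rightarrow> nat \<Rightarrow> (nat \<Rightarrow> nat \<Rightarrow> nat) \<Rightarrow> (nat \<Rightarrow> nat) set \<Rightarrow> bool" where
  "has_pattern D l j k \<pi> X \<longleftrightarrow> (\<exists>u T. pattern_at D l j k \<pi> X u T)"

lemma pattern_atD:
  assumes "pattern_at D l j k \<pi> X u T"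
  shows "t < k \<Longrightarrow> T t \<subseteq> line D l X (u t)"
    and "t < k \<Longrightarrow> card (T t) = j"
    and "i \<in> D - {l} \<Longrightarrow> t < k \<Longrightarrow> t' < k \<Longrightarrow> \<pi> i t < \<pi> i t' \<Longrightarrow> u t i < u t' i"
    and "t < k \<Longrightarrow> t' < k \<Longrightarrow> \<pi> l t < \<pi> l t' \<Longrightarrow> v \<in> T t \<Longrightarrow> v' \<in> T t' \<Longrightarrow> v < v'"
proof -
  note * = assms[unfolded pattern_at_def]
  note 1 = conjunct1[OF *] and 2 = conjunct1[OF conjunct2[OF *]] and 3 = conjunct2[OF conjunct2[OF *]]
  show "t < k \<Longrightarrow> T t \<subseteq> line D l X (u t)" "t < k \<Longrightarrow> card (T t) = j"
    using 1 by blast+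
  show "i \<in> D - {l} \<Longrightarrow> t < k \<Longrightarrow> t' < k \<Longrightarrow> \<pi> i t < \<pi> i t' \<Longrightarrow> u t i < u t' i"
    using 2 by blast
  show "t < k \<Longrightarrow> t' < k \<Longrightarrow> \<pi> l t < \<pi> l t' \<Longrightarrow> v \<in> T t \<Longrightarrow> v' \<in> T t' \<Longrightarrow> v < v'"
    using 3 by blast
qed

text \<open>It suffices to give each tuple a zone \<open>L t\<close> of positions holding at least
  \<open>j\<close> points: if zones are ordered as wholes, any \<open>j\<close> points kept from
  each are in the required order.\<close>

lemma has_patternI:
  assumes "\<And>t. t < k \<Longrightarrow> j \<le> card {v \<in> line D l X (u t). L t v}"
    and "\<And>i t t'. i \<in> D - {l} \<Longrightarrow> t < k \<Longrightarrow> t' < k \<Longrightarrow> \<pi> i t < \<pi> i t' \<Longrightarrow> u t i < u t' i"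
    and "\<And>t t' v v'. t < k \<Longrightarrow> t' < k \<Longrightarrow> \<pi> l t < \<pi> l t' \<Longrightarrow> L t v \<Longrightarrow> L t' v' \<Longrightarrow> v < v'"
  shows "has_pattern D l j k \<pi> X"
proof -
  have "\<forall>t. \<exists>S. t < k \<longrightarrow> S \<subseteq> {v \<in> line D l X (u t). L t v} \<and> card S = j"
    using assms(1) by (meson obtain_subset_with_card_n)
  from choice[OF this] obtain T
    where T: "\<And>t. t < k \<Longrightarrow> T t \<subseteq> {v \<in> line D l X (u t). L t v}" "\<And>t. t < k \<Longrightarrow> card (T t) = j"
    by blast
  show ?thesis
    unfolding has_pattern_def pattern_at_def
  proof (intro exI[of _ u] exI[of _ T] conjI allI impI ballI)
    fix t t' v v' assume "t < k" "t' < k" "\<pi> l t < \<pi> l t'" "v \<in> T t" "v' \<in> T t'"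
    then show "v < v'" using assms(3)[of t t' v v'] T(1)[of t] T(1)[of t'] by auto
  next
    fix t assume "t < k"
    then show "T t \<subseteq> line D l X (u t)" "card (T t) = j" using T[of t] by auto
  qed (use assms(2) in auto)
qed

lemma line_mono: "X \<subseteq> X' \<Longrightarrow> line D l X u \<subseteq> line D l X' u"
  by (auto simp: line_def)

lemma finite_line: "finite X \<Longrightarrow> finite (line D l X u)"
  by (rule finite_subset[of _ "(\<lambda>x. x l) ` X"]) (auto simp: line_def)

lemma has_pattern_mono:
  assumes "has_pattern D l j k \<pi> X" "X \<subseteq> X'"
  shows "has_pattern D l j k \<pi> X'"
proof -
  from assms(1) obtain u T where T: "pattern_at D l j k \<pi> X u T"
    by (auto simp: has_pattern_def)
  show ?thesis
  proof (rule has_patternI[of k j D l X' u "\<lambda>t v. v \<in> T t"])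
    fix t assume "t < k"
    then have "{v \<in> line D l X' (u t). v \<in> T t} = T t"
      using pattern_atD(1)[OF T] line_mono[OF assms(2), of D l "u t"] by auto
    then show "j \<le> card {v \<in> line D l X' (u t). v \<in> T t}"
      using pattern_atD(2)[OF T] \<open>t < k\<close> by simp
  qed (rule pattern_atD(3,4)[OF T]; assumption)+
qed

section \<open>Counting by fibers and by slices\<close>

lemma card_le_mult_fibers:
  assumes "finite A" "finite B" "f ` A \<subseteq> B" "\<And>b. b \<in> B \<Longrightarrow> card {a \<in> A. f a = b} \<le> m"
  shows "card A \<le> m * card B"
proof -
  have "A = (\<Union>b\<in>B. {a \<in> A. f a = b})" using assms(3) by auto
  then have "card A \<le> (\<Sum>b\<in>B. card {a \<in> A. f a = b})"
    using card_UN_le[OF assms(2), of "\<lambda>b. {a \<in> A. f a = b}"] by simp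
  also have "\<dots> \<le> card B * m" using sum_bounded_above[of B _ m] assms(4) by simp
  finally show ?thesis by (simp add: mult.commute)
qed

lemma restrict_eqD: "restrict x E = r \<Longrightarrow> i \<in> E \<Longrightarrow> x i = r i"
  by (drule fun_cong[of _ _ i]) simp

lemma PiE_eqI:
  assumes "x \<in> Pi\<^sub>E D A" "x' \<in> Pi\<^sub>E D A"
    and "restrict x (D - {i}) = restrict x' (D - {i})" "x i = x' i"
  shows "x = x'"
proof (rule PiE_ext[OF assms(1,2)])
  fix a assume "a \<in> D"
  then show "x a = x' a" using fun_cong[OF assms(3), of a] assms(4) by (cases "a = i") simp_all
qed

text \<open>Common form of the two dimension reductions. Within one class, given by a value
  \<open>c\<close> of coordinate \<open>i\<close> and a label \<open>m\<close>, deleting coordinate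
  \<open>i\<close> is injective, so a bound on the projected class bounds the class itself. The
  classes cover \<open>Z\<close>, and overlaps are harmless in a union bound.\<close>

lemma card_le_slices:
  assumes "finite D" "i \<in> D" "Z \<subseteq> D \<rightarrow>\<^sub>E {..<n}" "finite M"
    and Q: "\<And>z. z \<in> Z \<Longrightarrow> \<exists>m\<in>M. Q z m"
    and B: "\<And>c m. c < n \<Longrightarrow> m \<in> M \<Longrightarrow>
              card ((\<lambda>z. restrict z (D - {i})) ` {z \<in> Z. z i = c \<and> Q z m}) \<le> B"
  shows "card Z \<le> n * card M * B"
proof -
  have B': "card {z \<in> Z. z i = c \<and> Q z m} \<le> B" if "c < n" "m \<in> M" for c m
  proof -
    have "inj_on (\<lambda>z. restrict z (D - {i})) {z \<in> Z. z i = c \<and> Q z m}"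
    proof (rule inj_onI)
      fix z z' assume z: "z \<in> {z \<in> Z. z i = c \<and> Q z m}" "z' \<in> {z \<in> Z. z i = c \<and> Q z m}"
        and eq: "restrict z (D - {i}) = restrict z' (D - {i})"
      show "z = z'"
      proof (rule PiE_eqI[OF _ _ eq])
        show "z \<in> D \<rightarrow>\<^sub>E {..<n}" "z' \<in> D \<rightarrow>\<^sub>E {..<n}" using z assms(3) by blast+
        show "z i = z' i" using z by simp
      qed
    qed
    then show ?thesis using B[OF that] by (simp add: card_image)
  qed
  have "Z \<subseteq> (\<Union>p\<in>{..<n} \<times> M. {z \<in> Z. z i = fst p \<and> Q z (snd p)})"
  proof
    fix z assume z: "z \<in> Z"
    then obtain m where "m \<in> M" "Q z m" using Q by blast
    moreover have "z i < n" using z assms(2,3) by (auto simp: PiE_def Pi_def)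
    ultimately show "z \<in> (\<Union>p\<in>{..<n} \<times> M. {z \<in> Z. z i = fst p \<and> Q z (snd p)})"
      using z by (intro UN_I[of "(z i, m)"]) auto
  qed
  moreover have "finite Z"
    using assms(1,3) by (meson finite_PiE finite_lessThan finite_subset)
  ultimately have "card Z \<le> card (\<Union>p\<in>{..<n} \<times> M. {z \<in> Z. z i = fst p \<and> Q z (snd p)})"
    using assms(4) by (intro card_mono) auto
  also have "\<dots> \<le> (\<Sum>p\<in>{..<n} \<times> M. card {z \<in> Z. z i = fst p \<and> Q z (snd p)})"
    using assms(4) by (intro card_UN_le) auto
  also have "\<dots> \<le> card ({..<n} \<times> M) * B"
    using B' sum_bounded_above[of "{..<n} \<times> M" "\<lambda>p. card {z \<in> Z. z i = fst p \<and> Q z (snd p)}" B]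
    by auto
  finally show ?thesis by (simp add: card_cartesian_product)
qed

section \<open>Ordered selection and greedy scanning on a line\<close>

lemma sorted_list_of_set_nth_less:
  fixes K :: "nat set"
  assumes "p < q" "q < card K"
  shows "sorted_list_of_set K ! p < sorted_list_of_set K ! q"
  using strict_sorted_list_of_set[of K] assms
  by (simp add: sorted_wrt_iff_nth_less)

text \<open>The sorted elements of \<open>K\<close> are cut into blocks of length \<open>j\<close>,
  and index \<open>t\<close> receives block number \<open>\<sigma> t\<close>.\<close>

lemma split_into_consecutive:
  fixes K :: "nat set"
  assumes "j * k \<le> card K" "\<And>t. t < k \<Longrightarrow> \<sigma> t < k"
  shows "\<exists>T. (\<forall>t<k. T t \<subseteq> K \<and> card (T t) = j) \<and>
    (\<forall>t<k. \<forall>t'<k. \<sigma> t < \<sigma> t' \<longrightarrow> (\<forall>v\<in>T t. \<forall>v'\<in>T t'. v < v'))"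
proof (cases "k = 0 \<or> j = 0")
  case True then show ?thesis by (intro exI[of _ "\<lambda>_. {}"]) auto
next
  case False
  then have "finite K" using assms(1) by (metis card.infinite le_zero_eq mult_is_0)
  let ?e = "\<lambda>p. sorted_list_of_set K ! p"
  have lt: "\<sigma> t * j + r < card K" if "t < k" "r < j" for t r
  proof -
    have "\<sigma> t * j + r < \<sigma> t * j + j" using that by simp
    also have "\<dots> = Suc (\<sigma> t) * j" by simp
    also have "\<dots> \<le> k * j" using assms(2)[OF that(1)] by (intro mult_right_mono) auto
    finally show ?thesis using assms(1) by (simp add: mult.commute)
  qed
  show ?thesis
  proof (intro exI[of _ "\<lambda>t. (\<lambda>r. ?e (\<sigma> t * j + r)) ` {..<j}"] conjI allI impI ballI)
    fix t assume t: "t < k"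
    show "(\<lambda>r. ?e (\<sigma> t * j + r)) ` {..<j} \<subseteq> K"
    proof (rule image_subsetI)
      fix r assume "r \<in> {..<j}"
      then have "\<sigma> t * j + r < length (sorted_list_of_set K)" using lt[OF t] by simp
      from nth_mem[OF this] show "?e (\<sigma> t * j + r) \<in> K" using \<open>finite K\<close> by simp
    qed
    have "inj_on (\<lambda>r. ?e (\<sigma> t * j + r)) {..<j}"
    proof (rule linorder_inj_onI)
      fix r r' assume "r < r'" "r' \<in> {..<j}"
      then have "?e (\<sigma> t * j + r) < ?e (\<sigma> t * j + r')"
        using lt[OF t] by (intro sorted_list_of_set_nth_less) auto
      then show "?e (\<sigma> t * j + r) \<noteq> ?e (\<sigma> t * j + r')" by simp
    qed auto
    then show "card ((\<lambda>r. ?e (\<sigma> t * j + r)) ` {..<j}) = j" by (simp add: card_image)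
  next
    fix t t' v v' assume t: "t < k" "t' < k" "\<sigma> t < \<sigma> t'"
      "v \<in> (\<lambda>r. ?e (\<sigma> t * j + r)) ` {..<j}" "v' \<in> (\<lambda>r. ?e (\<sigma> t' * j + r)) ` {..<j}"
    then obtain r r' where r: "r < j" "r' < j" "v = ?e (\<sigma> t * j + r)" "v' = ?e (\<sigma> t' * j + r')"
      by auto
    have "\<sigma> t * j + r < Suc (\<sigma> t) * j" using r by simp
    also have "\<dots> \<le> \<sigma> t' * j" using t by (intro mult_right_mono) auto
    finally show "v < v'" using r t lt by (auto intro!: sorted_list_of_set_nth_less)
  qed
qed

text \<open>Greedy scan along a row of cubes: the value at \<open>p\<close> is the first cube of the
  chunk containing cube \<open>p\<close>. The intended \<open>full a b\<close> concerns the cubes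
  \<open>a, ..., b - 1\<close>, so a chunk includes the cube that makes it full and the next cube
  opens a new chunk.\<close>

primrec chunk_start :: "(nat \<Rightarrow> nat \<Rightarrow> bool) \<Rightarrow> nat \<Rightarrow> nat" where
  "chunk_start full 0 = 0"
| "chunk_start full (Suc p) =
     (if full (chunk_start full p) (Suc p) then Suc p else chunk_start full p)"

lemma chunk_start_le: "chunk_start full p \<le> p"
  by (induction p) auto

lemma chunk_start_mono: "p \<le> q \<Longrightarrow> chunk_start full p \<le> chunk_start full q"
proof (induction rule: dec_induct)
  case (step n) then show ?case using chunk_start_le[of full n] by auto
qed simp

lemma chunk_start_idem: "chunk_start full (chunk_start full p) = chunk_start full p"
  by (induction p) auto

text \<open>Had the part of the chunk before cube \<open>p\<close> been full, \<open>p\<close> would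
  have opened a new chunk. If \<open>p\<close> is itself a start, this part is empty, whence the
  assumption.\<close>

lemma not_full_chunk_start:
  assumes "\<And>a. \<not> full a a"
  shows "\<not> full (chunk_start full p) p"
  using assms by (induction p) auto

text \<open>A chunk is full when the next one opens, and by monotonicity it stays full up to any
  later start.\<close>

lemma full_between_chunk_starts:
  assumes mono: "\<And>a b c. full a b \<Longrightarrow> b \<le> c \<Longrightarrow> full a c"
    and "chunk_start full p < chunk_start full q"
  shows "full (chunk_start full p) (chunk_start full q)"
  using assms(2)
proof (induction q)
  case (Suc q)
  show ?case
  proof (cases "full (chunk_start full q) (Suc q)")
    case True
    consider "chunk_start full p < chunk_start full q" | "chunk_start full p = chunk_start full q"
      | "chunk_start full q < chunk_start full p" by linarith
    then show ?thesis
    proof cases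
      case 1
      then have "full (chunk_start full p) (chunk_start full q)" by (rule Suc.IH)
      then show ?thesis using True mono[of _ _ "Suc q"] chunk_start_le[of full q] by simp
    next
      case 2 then show ?thesis using True by simp
    next
      case 3
      then have "q < p" using chunk_start_mono[of p q full] by (meson leD not_le)
      then show ?thesis using chunk_start_mono[of "Suc q" p full] Suc.prems by simp
    qed
  qed (use Suc in auto)
qed simp

subsection \<open>Contraction to chunks\<close>

lemma less_div_mult_add: "0 < s \<Longrightarrow> a < a div s * s + s" for a s :: nat
  using div_mult_mod_eq[of a s] mod_less_divisor[of s a] by linarith

lemma add_le_if_mod_eq:
  fixes a b m :: nat
  assumes "a < b" "a mod m = b mod m"
  shows "a + m \<le> b"
proof -
  have "m dvd b - a" using mod_eq_dvd_iff_nat[of a b m] assms by simp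
  then have "m \<le> b - a" using assms(1) by (intro dvd_imp_le) auto
  then show ?thesis using assms(1) by simp
qed

lemma restrict_image_subset_PiE:
  assumes "Z \<subseteq> D \<rightarrow>\<^sub>E A" "E \<subseteq> D"
  shows "(\<lambda>z. restrict z E) ` Z \<subseteq> E \<rightarrow>\<^sub>E A"
proof (rule image_subsetI)
  fix z assume "z \<in> Z"
  then have "\<forall>i\<in>E. z i \<in> A" using assms by blast
  then show "restrict z E \<in> E \<rightarrow>\<^sub>E A" by (simp add: restrict_PiE_iff)
qed

lemma less_if_div_less: "a div s < b div s \<Longrightarrow> a < b" for a b s :: nat
  by (meson div_le_mono leD not_le)

text \<open>
  The grid is cut into cubes of side \<open>s\<close>, and in each row of cubes in direction \<open>l\<close> consecutive
  cubes are merged into chunks. The bound \<open>B\<close> is the one available in one dimension less.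
\<close>

locale contraction =
  fixes D :: "nat set" and l s n j k :: nat and \<pi> :: "nat \<Rightarrow> nat \<Rightarrow> nat"
    and X :: "(nat \<Rightarrow> nat) set" and B :: nat
  assumes fin_D: "finite D" and l: "l \<in> D" and card_D: "card D \<ge> 2"
    and s: "s > 0" and j: "j \<ge> 2" and k: "k \<ge> 1"
    and X: "X \<subseteq> D \<rightarrow>\<^sub>E {..<s * n}"
    and \<pi>: "\<And>i t. i \<in> D \<Longrightarrow> t < k \<Longrightarrow> \<pi> i t < k"
    and avoids: "\<not> has_pattern D l j k \<pi> X"
    and lower_dim: "\<And>i l' Z. i \<in> D \<Longrightarrow> l' \<in> D - {i} \<Longrightarrow> Z \<subseteq> (D - {i}) \<rightarrow>\<^sub>E {..<n} \<Longrightarrow>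
      \<not> has_pattern (D - {i}) l' j k \<pi> Z \<Longrightarrow> card Z \<le> B"
begin

section \<open>Heavy cubes\<close>

definition blk :: "(nat \<Rightarrow> nat) \<Rightarrow> nat \<Rightarrow> nat" where
  "blk x = (\<lambda>i\<in>D. x i div s)"

text \<open>The threshold \<open>j * k\<close> lets the positions on a single line inside one cube
  be cut into \<open>k\<close> ordered sets of size \<open>j\<close>.\<close>

definition heavy :: "(nat \<Rightarrow> nat) \<Rightarrow> bool" where
  "heavy b \<longleftrightarrow> (\<exists>u. (\<forall>i\<in>D - {l}. u i div s = b i) \<and> j * k \<le> card {v \<in> line D l X u. v div s = b l})"

definition heavy_blocks :: "(nat \<Rightarrow> nat) set" where "heavy_blocks = {b \<in> blk ` X. heavy b}"

definition light :: "(nat \<Rightarrow> nat) set" where "light = {x \<in> X. \<not> heavy (blk x)}"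

lemma finite_X: "finite X"
  using X fin_D by (meson finite_PiE finite_lessThan finite_subset)

lemma light_subset: "light \<subseteq> X" by (auto simp: light_def)

lemma finite_light: "finite light" using light_subset finite_X finite_subset by blast

lemma coord_div_less: "x \<in> X \<Longrightarrow> i \<in> D \<Longrightarrow> x i div s < n"
  using X s by (auto simp: less_mult_imp_div_less PiE_def Pi_def mult.commute)

lemma heavy_blocks_subset: "heavy_blocks \<subseteq> D \<rightarrow>\<^sub>E {..<n}"
  using coord_div_less by (auto simp: heavy_blocks_def blk_def)

text \<open>A heavy cube is labelled by a set \<open>K\<close> of at least \<open>j * k\<close>
  offsets at which one of its lines in direction \<open>l\<close> has points; there are
  \<open>2 ^ s\<close> possible labels. Cubes with the same label and the same
  \<open>l\<close>-index avoid the pattern with coordinate \<open>l\<close> deleted: in a copy,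
  every cube would offer the same set \<open>K\<close>, from which the \<open>k\<close> tuples can
  be chosen in the required order.\<close>

lemma card_heavy_blocks_le: "card heavy_blocks \<le> n * 2 ^ s * B"
proof -
  define Q where "Q b K \<longleftrightarrow> j * k \<le> card K \<and>
    (\<exists>u. (\<forall>i\<in>D - {l}. u i div s = b i) \<and> (\<forall>\<kappa>\<in>K. b l * s + \<kappa> \<in> line D l X u))" for b K
  have "card heavy_blocks \<le> n * card (Pow {..<s}) * B"
  proof (rule card_le_slices[OF fin_D l heavy_blocks_subset, where Q = Q])
    fix b assume "b \<in> heavy_blocks"
    then obtain u where u: "\<forall>i\<in>D - {l}. u i div s = b i"
        "j * k \<le> card {v \<in> line D l X u. v div s = b l}"
      by (auto simp: heavy_blocks_def heavy_def)
    let ?K = "(\<lambda>v. v mod s) ` {v \<in> line D l X u. v div s = b l}"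
    have "inj_on (\<lambda>v. v mod s) {v \<in> line D l X u. v div s = b l}"
      by (rule inj_onI) (metis (mono_tags, lifting) div_mult_mod_eq mem_Collect_eq)
    then have "j * k \<le> card ?K" using u by (simp add: card_image)
    moreover have "\<forall>\<kappa>\<in>?K. b l * s + \<kappa> \<in> line D l X u"
    proof
      fix \<kappa> assume "\<kappa> \<in> ?K"
      then obtain v where v: "v \<in> line D l X u" "v div s = b l" "\<kappa> = v mod s" by auto
      then have "b l * s + \<kappa> = v" by (metis div_mult_mod_eq)
      then show "b l * s + \<kappa> \<in> line D l X u" using v by simp
    qed
    ultimately have "Q b ?K" using u unfolding Q_def by blast
    moreover have "?K \<in> Pow {..<s}" using s by auto
    ultimately show "\<exists>K\<in>Pow {..<s}. Q b K" by blast
  next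
    fix c K assume c: "c < n" and K: "K \<in> Pow {..<s}"
    define Z where "Z = (\<lambda>z. restrict z (D - {l})) ` {z \<in> heavy_blocks. z l = c \<and> Q z K}"
    have "card (D - {l}) \<noteq> 0" using card_D fin_D l by simp
    then obtain l' where l': "l' \<in> D - {l}" by (metis card.empty ex_in_conv)
    have "{z \<in> heavy_blocks. z l = c \<and> Q z K} \<subseteq> D \<rightarrow>\<^sub>E {..<n}" using heavy_blocks_subset by blast
    from restrict_image_subset_PiE[OF this Diff_subset]
    have "Z \<subseteq> (D - {l}) \<rightarrow>\<^sub>E {..<n}" unfolding Z_def .
    moreover have "\<not> has_pattern (D - {l}) l' j k \<pi> Z"
    proof
      assume "has_pattern (D - {l}) l' j k \<pi> Z"
      then obtain u T where T: "pattern_at (D - {l}) l' j k \<pi> Z u T" by (auto simp: has_pattern_def)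
      note T = pattern_atD[OF T]
      \<comment> \<open>Of the \<open>j\<close> cubes of the \<open>t\<close>-th tuple only one is
        taken, at position \<open>v\<close> in direction \<open>l'\<close>; \<open>w\<close> is its
        line with points at all offsets in \<open>K\<close>.\<close>
      have ex: "\<exists>w. t < k \<longrightarrow> j * k \<le> card K \<and> (\<exists>v\<in>T t. \<forall>i\<in>D - {l}. w i div s = (if i = l' then v else u t i)) \<and>
         (\<forall>\<kappa>\<in>K. c * s + \<kappa> \<in> line D l X w)" for t
      proof (cases "t < k")
        case True
        then have "T t \<noteq> {}" using T(2)[of t] j by auto
        then obtain v where v: "v \<in> T t" by blast
        then obtain z where z: "z \<in> Z" "z l' = v" "\<forall>i\<in>D - {l} - {l'}. z i = u t i"
          using T(1)[OF True] by (auto simp: line_def)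
        then obtain b where b: "z = restrict b (D - {l})" "b l = c" "Q b K"
          by (auto simp: Z_def)
        then obtain w where w: "\<forall>i\<in>D - {l}. w i div s = b i" "\<forall>\<kappa>\<in>K. b l * s + \<kappa> \<in> line D l X w"
          by (auto simp: Q_def)
        have "\<forall>i\<in>D - {l}. w i div s = (if i = l' then v else u t i)"
          using w(1) z b(1) by auto
        then show ?thesis using v w(2) b(2,3) unfolding Q_def by blast
      qed auto
      from choice[OF allI[OF ex]] obtain W where "\<forall>t. t < k \<longrightarrow> j * k \<le> card K \<and>
         (\<exists>v\<in>T t. \<forall>i\<in>D - {l}. W t i div s = (if i = l' then v else u t i)) \<and>
         (\<forall>\<kappa>\<in>K. c * s + \<kappa> \<in> line D l X (W t))" ..
      note W = this[THEN spec, THEN mp]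
      then have "j * k \<le> card K" using k by auto
      \<comment> \<open>All chosen lines carry the offsets \<open>K\<close> in cubes of the same
        \<open>l\<close>-index \<open>c\<close>, so consecutive pieces of \<open>K\<close> give
        tuples ordered as \<open>\<pi> l\<close> demands.\<close>
      from split_into_consecutive[OF this, where \<sigma> = "\<pi> l", OF \<pi>[OF l]] obtain S where
        S: "(\<forall>t<k. S t \<subseteq> K \<and> card (S t) = j) \<and>
          (\<forall>t<k. \<forall>t'<k. \<pi> l t < \<pi> l t' \<longrightarrow> (\<forall>v\<in>S t. \<forall>v'\<in>S t'. v < v'))" ..
      have "has_pattern D l j k \<pi> X"
      proof (rule has_patternI[of k j D l X W "\<lambda>t v. v \<in> (\<lambda>\<kappa>. c * s + \<kappa>) ` S t"])
        fix t assume t: "t < k"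
        have "{v \<in> line D l X (W t). v \<in> (\<lambda>\<kappa>. c * s + \<kappa>) ` S t} = (\<lambda>\<kappa>. c * s + \<kappa>) ` S t"
          using W[OF t] S t by blast
        then show "j \<le> card {v \<in> line D l X (W t). v \<in> (\<lambda>\<kappa>. c * s + \<kappa>) ` S t}"
          using S t by (simp add: card_image)
      next
        fix i t t' assume i: "i \<in> D - {l}" and t: "t < k" "t' < k" "\<pi> i t < \<pi> i t'"
        obtain v v' where v: "v \<in> T t" "v' \<in> T t'"
           "\<forall>i\<in>D - {l}. W t i div s = (if i = l' then v else u t i)"
           "\<forall>i\<in>D - {l}. W t' i div s = (if i = l' then v' else u t' i)"
          using W[OF t(1)] W[OF t(2)] by blast
        have "W t i div s < W t' i div s"
        proof (cases "i = l'")
          case True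
          then have "v < v'" using T(4)[OF t(1,2) _ v(1,2)] t(3) by simp
          then show ?thesis using v(3,4) i True by simp
        next
          case False
          then have "u t i < u t' i" using T(3)[OF _ t] i by simp
          then show ?thesis using v(3,4) i False by simp
        qed
        then show "W t i < W t' i" by (rule less_if_div_less)
      next
        fix t t' v v' assume t: "t < k" "t' < k" "\<pi> l t < \<pi> l t'"
          and v: "v \<in> (\<lambda>\<kappa>. c * s + \<kappa>) ` S t" "v' \<in> (\<lambda>\<kappa>. c * s + \<kappa>) ` S t'"
        then obtain \<kappa> \<kappa>' where "\<kappa> \<in> S t" "v = c * s + \<kappa>" "\<kappa>' \<in> S t'" "v' = c * s + \<kappa>'" by blast
        moreover from this have "\<kappa> < \<kappa>'" using S t by blast
        ultimately show "v < v'" by simp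
      qed
      then show False using avoids by simp
    qed
    ultimately show "card ((\<lambda>z. restrict z (D - {l})) ` {z \<in> heavy_blocks. z l = c \<and> Q z K}) \<le> B"
      using lower_dim[OF l l'] unfolding Z_def by blast
  qed simp
  then show ?thesis by (simp add: card_Pow)
qed

lemma card_block_le: "card {x \<in> X. blk x = b} \<le> s ^ card D"
proof -
  have "{x \<in> X. blk x = b} \<subseteq> Pi\<^sub>E D (\<lambda>i. {b i * s..<b i * s + s})"
  proof
    fix x assume "x \<in> {x \<in> X. blk x = b}"
    then have x: "x \<in> X" "b = blk x" by auto
    have "x i \<in> {b i * s..<b i * s + s}" if "i \<in> D" for i
      using that s x(2) by (auto simp: blk_def intro!: less_div_mult_add)
    then show "x \<in> Pi\<^sub>E D (\<lambda>i. {b i * s..<b i * s + s})" using x X by (auto simp: PiE_def)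
  qed
  then have "card {x \<in> X. blk x = b} \<le> card (Pi\<^sub>E D (\<lambda>i. {b i * s..<b i * s + s}))"
    using fin_D by (intro card_mono finite_PiE) auto
  also have "\<dots> = s ^ card D" using fin_D by (simp add: card_PiE)
  finally show ?thesis .
qed

lemma card_X_le: "card X \<le> card light + s ^ card D * card heavy_blocks"
proof -
  have "X = light \<union> {x \<in> X. heavy (blk x)}" by (auto simp: light_def)
  then have "card X \<le> card light + card {x \<in> X. heavy (blk x)}" using card_Un_le by metis
  moreover have "card {x \<in> X. heavy (blk x)} \<le> s ^ card D * card heavy_blocks"
  proof (rule card_le_mult_fibers[where f = blk])
    show "finite {x \<in> X. heavy (blk x)}" "finite heavy_blocks" using finite_X by (auto simp: heavy_blocks_def)
    show "blk ` {x \<in> X. heavy (blk x)} \<subseteq> heavy_blocks" by (auto simp: heavy_blocks_def)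
    fix b
    have "card {a \<in> {x \<in> X. heavy (blk x)}. blk a = b} \<le> card {x \<in> X. blk x = b}"
      using finite_X by (intro card_mono) auto
    then show "card {a \<in> {x \<in> X. heavy (blk x)}. blk a = b} \<le> s ^ card D"
      using card_block_le[of b] by simp
  qed
  ultimately show ?thesis by simp
qed

lemma card_line_in_block_less: "card {v \<in> line D l light u. v div s = p} < j * k"
proof (cases "{v \<in> line D l light u. v div s = p} = {}")
  case True then show ?thesis using j k by (simp only: card.empty) simp
next
  case False
  then obtain x where x: "x \<in> light" "\<forall>i\<in>D - {l}. x i = u i" "x l div s = p"
    by (auto simp: line_def)
  then have "\<not> heavy (blk x)" by (auto simp: light_def)
  moreover have "\<forall>i\<in>D - {l}. u i div s = blk x i" using x(2) by (simp add: blk_def)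
  ultimately have "\<not> j * k \<le> card {v \<in> line D l X u. v div s = blk x l}"
    unfolding heavy_def by blast
  then have "card {v \<in> line D l X u. v div s = p} < j * k"
    using x(3) l by (simp add: blk_def)
  moreover have "card {v \<in> line D l light u. v div s = p} \<le> card {v \<in> line D l X u. v div s = p}"
    using line_mono[OF light_subset] finite_line[OF finite_X] by (intro card_mono) auto
  ultimately show ?thesis by simp
qed

section \<open>Contraction of rows to chunks\<close>

definition row :: "(nat \<Rightarrow> nat) \<Rightarrow> nat \<Rightarrow> nat" where
  "row x = (\<lambda>i\<in>D - {l}. x i div s)"

text \<open>
  A chunk is closed as soon as some line has \<open>j\<close> points in it. Hence two chunk starts in one row
  enclose such a line, which lets a pattern among the chunk starts be lifted to \<open>X\<close>.
\<close>

definition full :: "(nat \<Rightarrow> nat) \<Rightarrow> nat \<Rightarrow> nat \<Rightarrow> bool" where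
  "full \<rho> a p \<longleftrightarrow> (\<exists>u. (\<forall>i\<in>D - {l}. u i div s = \<rho> i) \<and>
     j \<le> card {v \<in> line D l light u. a \<le> v div s \<and> v div s < p})"

text \<open>A chunk is named by the index vector of its first cube, so that the chunk names form a
  point set in the smaller grid, to which induction on the side length applies.\<close>

definition key :: "(nat \<Rightarrow> nat) \<Rightarrow> nat \<Rightarrow> nat" where
  "key x = (row x)(l := chunk_start (full (row x)) (x l div s))"

definition chunks :: "(nat \<Rightarrow> nat) set" where "chunks = key ` light"

definition fiber :: "(nat \<Rightarrow> nat) \<Rightarrow> (nat \<Rightarrow> nat) set" where
  "fiber y = {x \<in> light. key x = y}"

lemma key_l: "key x l = chunk_start (full (row x)) (x l div s)"
  by (simp add: key_def)

lemma key_other: "i \<in> D - {l} \<Longrightarrow> key x i = x i div s"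
  by (auto simp: key_def row_def)

lemma row_eqI: "(\<And>i. i \<in> D - {l} \<Longrightarrow> key x i = \<rho> i) \<Longrightarrow> row x = restrict \<rho> (D - {l})"
  by (rule ext) (auto simp: row_def restrict_def key_other)

lemma full_mono: "full \<rho> a b \<Longrightarrow> b \<le> c \<Longrightarrow> full \<rho> a c"
proof -
  assume "full \<rho> a b" "b \<le> c"
  then obtain u where u: "\<forall>i\<in>D - {l}. u i div s = \<rho> i"
     "j \<le> card {v \<in> line D l light u. a \<le> v div s \<and> v div s < b}" by (auto simp: full_def)
  have "card {v \<in> line D l light u. a \<le> v div s \<and> v div s < b} \<le>
     card {v \<in> line D l light u. a \<le> v div s \<and> v div s < c}"
    using finite_line[OF finite_light] \<open>b \<le> c\<close> by (intro card_mono) auto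
  then show "full \<rho> a c" using u unfolding full_def by (meson order_trans)
qed

lemma not_full_refl: "\<not> full \<rho> a a"
proof -
  have "{v \<in> line D l light u. a \<le> v div s \<and> v div s < a} = {}" for u by auto
  then show ?thesis using j unfolding full_def by (simp only: card.empty) simp
qed

lemma chunks_subset: "chunks \<subseteq> D \<rightarrow>\<^sub>E {..<n}"
proof
  fix y assume "y \<in> chunks"
  then obtain x where x: "x \<in> X" "y = key x" using light_subset by (auto simp: chunks_def)
  have "y i < n" if "i \<in> D" for i
    using coord_div_less[OF x(1) that] chunk_start_le[of "full (row x)" "x l div s"] that x(2)
    by (cases "i = l") (auto simp: key_l key_other)
  moreover have "y i = undefined" if "i \<notin> D" for i
    using that l by (auto simp: x(2) key_def row_def)
  ultimately show "y \<in> D \<rightarrow>\<^sub>E {..<n}" by (auto simp: PiE_def extensional_def)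
qed

lemma finite_chunks: "finite chunks" using finite_light by (simp add: chunks_def)

text \<open>A copy among the chunk starts lifts to \<open>X\<close>: as \<open>j \<ge> 2\<close>,
  the least and greatest members of each \<open>T t\<close> are two different chunk starts of one
  row, and the cubes between them contain a line with \<open>j\<close> points. These stretches
  inherit the order of the sets \<open>T t\<close>.\<close>

lemma chunks_avoids: "\<not> has_pattern D l j k \<pi> chunks"
proof
  assume "has_pattern D l j k \<pi> chunks"
  then obtain u T where T: "pattern_at D l j k \<pi> chunks u T" by (auto simp: has_pattern_def)
  note T = pattern_atD[OF T]
  have fin_T: "finite (T t)" "T t \<noteq> {}" if "t < k" for t
    using T(2)[OF that] j by (auto intro: card_ge_0_finite)
  have ex: "\<exists>w. t < k \<longrightarrow> (\<forall>i\<in>D - {l}. w i div s = u t i) \<and>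
      j \<le> card {v \<in> line D l light w. Min (T t) \<le> v div s \<and> v div s < Max (T t)}" for t
  proof (cases "t < k")
    case True
    note fin = fin_T[OF True]
    have "\<not> is_singleton (T t)" using T(2)[OF True] j by (auto simp: is_singleton_altdef)
    then have less: "Min (T t) < Max (T t)"
      using fin by (metis Max_ge Min_in Min_le is_singletonI' le_antisym not_le order_trans)
    have "Min (T t) \<in> line D l chunks (u t)" "Max (T t) \<in> line D l chunks (u t)"
      using T(1)[OF True] Min_in[OF fin] Max_in[OF fin] by auto
    then obtain x x' where x: "Min (T t) = key x l" "\<forall>i\<in>D - {l}. key x i = u t i"
      "Max (T t) = key x' l" "\<forall>i\<in>D - {l}. key x' i = u t i"
      by (auto simp: line_def chunks_def)
    define \<rho> where "\<rho> = restrict (u t) (D - {l})"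
    have row: "row x = \<rho>" "row x' = \<rho>" unfolding \<rho>_def using x by (auto intro!: row_eqI)
    have "full \<rho> (Min (T t)) (Max (T t))"
      using less unfolding x(1,3) key_l row
      by (rule full_between_chunk_starts[rotated]) (rule full_mono)
    then show ?thesis by (auto simp: full_def \<rho>_def)
  qed auto
  from choice[OF allI[OF ex]] obtain W where "\<forall>t. t < k \<longrightarrow> (\<forall>i\<in>D - {l}. W t i div s = u t i) \<and>
      j \<le> card {v \<in> line D l light (W t). Min (T t) \<le> v div s \<and> v div s < Max (T t)}" ..
  note W = this[THEN spec, THEN mp]
  have "has_pattern D l j k \<pi> light"
  proof (rule has_patternI[of k j D l light W "\<lambda>t v. Min (T t) \<le> v div s \<and> v div s < Max (T t)"])
    show "j \<le> card {v \<in> line D l light (W t). Min (T t) \<le> v div s \<and> v div s < Max (T t)}" if "t < k" for t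
      using W[OF that] by blast
  next
    fix i t t' assume i: "i \<in> D - {l}" and t: "t < k" "t' < k" "\<pi> i t < \<pi> i t'"
    have "W t i div s < W t' i div s" using T(3)[OF i t] W[OF t(1)] W[OF t(2)] i by simp
    then show "W t i < W t' i" by (rule less_if_div_less)
  next
    fix t t' v v' assume t: "t < k" "t' < k" "\<pi> l t < \<pi> l t'"
      and v: "Min (T t) \<le> v div s \<and> v div s < Max (T t)" "Min (T t') \<le> v' div s \<and> v' div s < Max (T t')"
    have "Max (T t) < Min (T t')"
      using T(4)[OF t Max_in[OF fin_T[OF t(1)]] Min_in[OF fin_T[OF t(2)]]] .
    then have "v div s < v' div s" using v by simp
    then show "v < v'" by (rule less_if_div_less)
  qed
  then show False using avoids has_pattern_mono light_subset by blast
qed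

text \<open>On a line inside a chunk, the cubes before the last one with a point of the fiber hold
  fewer than \<open>j\<close> points, because the chunk is not full there; that last cube holds
  fewer than \<open>j * k\<close>, because it is not heavy.\<close>

lemma card_fiber_line_le: "card {x \<in> fiber y. restrict x (D - {l}) = r} \<le> 2 * j * k"
proof (cases "{x \<in> fiber y. restrict x (D - {l}) = r} = {}")
  case False
  define A where "A = {x \<in> fiber y. restrict x (D - {l}) = r}"
  have A: "x \<in> light" "key x = y" "restrict x (D - {l}) = r" if "x \<in> A" for x
    using that by (simp_all add: A_def fiber_def)
  have A_PiE: "x \<in> D \<rightarrow>\<^sub>E {..<s * n}" if "x \<in> A" for x
    using A(1)[OF that] X light_subset by blast
  have A_coord: "\<forall>i\<in>D - {l}. x i = r i" if "x \<in> A" for x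
    using restrict_eqD[OF A(3)[OF that]] by blast
  define P where "P = (\<lambda>x. x l div s) ` A"
  have fin: "finite A" using finite_light by (rule rev_finite_subset) (use A(1) in blast)
  have "finite P" using fin by (simp add: P_def)
  moreover have "P \<noteq> {}" using False unfolding P_def A_def by (simp only: image_is_empty not_False_eq_True)
  ultimately have "Max P \<in> P" by (rule Max_in)
  moreover have "\<exists>z\<in>A. z l div s = p" if "p \<in> P" for p using that by (auto simp: P_def)
  \<comment> \<open>\<open>z\<close> lies in the last cube met; the chunk of that cube starts at
    \<open>y l\<close>, so the stretch \<open>?L1\<close> before it is not full.\<close>
  ultimately obtain z where z: "z \<in> A" "z l div s = Max P" by blast
  let ?L1 = "{v \<in> line D l light r. y l \<le> v div s \<and> v div s < Max P}"
  let ?L2 = "{v \<in> line D l light r. v div s = Max P}"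
  have "inj_on (\<lambda>x. x l) A"
  proof (rule inj_onI)
    fix x x' assume x: "x \<in> A" "x' \<in> A" "x l = x' l"
    have "restrict x (D - {l}) = restrict x' (D - {l})" using A(3)[OF x(1)] A(3)[OF x(2)] by (rule trans[OF _ sym])
    then show "x = x'" using x(3) by (rule PiE_eqI[OF A_PiE[OF x(1)] A_PiE[OF x(2)]])
  qed
  moreover have "(\<lambda>x. x l) ` A \<subseteq> ?L1 \<union> ?L2"
  proof (rule image_subsetI)
    fix x assume x: "x \<in> A"
    then have "x l \<in> line D l light r" unfolding line_def using A(1)[OF x] A_coord[OF x] by blast
    moreover have "x l div s \<le> Max P" using x \<open>finite P\<close> by (auto simp: P_def)
    moreover have "y l \<le> x l div s"
      using chunk_start_le[of "full (row x)" "x l div s"] A(2)[OF x] key_l[of x] by simp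
    ultimately show "x l \<in> ?L1 \<union> ?L2" by auto
  qed
  moreover have "finite (?L1 \<union> ?L2)" using finite_line[OF finite_light] by auto
  ultimately have "card A \<le> card (?L1 \<union> ?L2)" by (rule card_inj_on_le)
  also have "\<dots> \<le> card ?L1 + card ?L2" by (rule card_Un_le)
  also have "\<dots> \<le> j + j * k"
  proof (rule add_mono)
    have "\<not> full (row z) (y l) (z l div s)"
      using not_full_chunk_start[of "full (row z)" "z l div s"] not_full_refl A(2)[OF z(1)] key_l[of z] by simp
    moreover have "\<forall>i\<in>D - {l}. r i div s = row z i" using A_coord[OF z(1)] by (simp add: row_def)
    ultimately show "card ?L1 \<le> j" unfolding full_def z(2) by (meson le_cases)
    show "card ?L2 \<le> j * k" using card_line_in_block_less[of r "Max P"] by simp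
  qed
  also have "\<dots> \<le> 2 * j * k" using k by simp
  finally show ?thesis by (simp add: A_def)
next
  case True
  then show ?thesis by (simp only: card.empty)
qed

lemma card_fiber_le:
  assumes w: "\<And>i. i \<in> D - {l} \<Longrightarrow> card ((\<lambda>x. x i) ` fiber y) \<le> w"
  shows "card (fiber y) \<le> 2 * j * k * w ^ (card D - 1)"
proof -
  have fin: "finite (fiber y)" using finite_light by (auto simp: fiber_def)
  let ?P = "Pi\<^sub>E (D - {l}) (\<lambda>i. (\<lambda>x. x i) ` fiber y)"
  have "card (fiber y) \<le> 2 * j * k * card ?P"
  proof (rule card_le_mult_fibers[where f = "\<lambda>x. restrict x (D - {l})"])
    show "finite ?P" using fin_D fin by (intro finite_PiE) auto
    show "(\<lambda>x. restrict x (D - {l})) ` fiber y \<subseteq> ?P"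
      by (rule image_subsetI) (auto simp only: restrict_PiE_iff)
  qed (use fin card_fiber_line_le in auto)
  also have "card ?P = (\<Prod>i\<in>D - {l}. card ((\<lambda>x. x i) ` fiber y))" using fin_D by (simp add: card_PiE)
  also have "\<dots> \<le> (\<Prod>i\<in>D - {l}. w)" using w by (intro prod_mono) auto
  also have "\<dots> = w ^ (card D - 1)" using fin_D l by simp
  finally show ?thesis by simp
qed

section \<open>Wide chunks\<close>

definition offsets :: "nat \<Rightarrow> (nat \<Rightarrow> nat) \<Rightarrow> nat set" where
  "offsets i y = (\<lambda>x. x i mod s) ` fiber y"

text \<open>The threshold is \<open>k\<close> because \<open>k\<close> offsets in direction
  \<open>i\<close> allow all \<open>k\<close> ranks of coordinate \<open>i\<close> to be realised
  inside one layer of cubes.\<close>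

definition wide :: "nat \<Rightarrow> (nat \<Rightarrow> nat) set" where
  "wide i = {y \<in> chunks. k \<le> card (offsets i y)}"

lemma offsets_subset: "offsets i y \<subseteq> {..<s}"
  using s by (auto simp: offsets_def)

text \<open>All cubes of a chunk have the same index in a direction \<open>i\<close> other than
  \<open>l\<close>, so offsets determine coordinates.\<close>

lemma card_coord_image:
  assumes "i \<in> D - {l}"
  shows "card ((\<lambda>x. x i) ` fiber y) = card (offsets i y)"
proof -
  have "inj_on (\<lambda>v. v mod s) ((\<lambda>x. x i) ` fiber y)"
  proof (rule inj_onI)
    fix v v' assume v: "v \<in> (\<lambda>x. x i) ` fiber y" "v' \<in> (\<lambda>x. x i) ` fiber y" "v mod s = v' mod s"
    then have "v div s = y i" "v' div s = y i"
      using key_other[OF assms] by (auto simp: fiber_def simp flip: key_other[OF assms])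
    then show "v = v'" using v(3) by (metis div_mult_mod_eq)
  qed
  then have "card ((\<lambda>v. v mod s) ` ((\<lambda>x. x i) ` fiber y)) = card ((\<lambda>x. x i) ` fiber y)"
    by (rule card_image)
  then show ?thesis by (simp add: offsets_def image_image)
qed

text \<open>
  Classes of wide chunks with equal \<open>K\<close> and equal rank modulo \<open>j * s ^ card D\<close>: between two members
  of a class lie so many wide chunks that, for every offset in \<open>K\<close>, the pigeonhole principle yields
  a line with \<open>j\<close> points. So each class, sliced along \<open>i\<close>, avoids the pattern with coordinate \<open>i\<close>
  deleted.
\<close>

definition rank :: "nat \<Rightarrow> nat set \<Rightarrow> (nat \<Rightarrow> nat) \<Rightarrow> nat" where
  "rank i K y = card {y' \<in> chunks. K \<subseteq> offsets i y' \<and> (\<forall>i\<in>D - {l}. y' i = y i) \<and> y' l < y l}"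

text \<open>In each chunk from \<open>y\<close> up to, but excluding, \<open>y'\<close> whose
  offsets include \<open>K\<close>, choose a point with \<open>i\<close>-th offset
  \<open>\<kappa>\<close>. There are at least \<open>j * s ^ card D\<close> such chunks but only
  \<open>s ^ (card D - 1)\<close> lines through this row, so some line receives \<open>j\<close> of
  the chosen points.\<close>

lemma many_wide_chunks_give_lines:
  assumes i: "i \<in> D - {l}" and \<kappa>: "\<kappa> \<in> K"
    and y: "y \<in> chunks" "y' \<in> chunks" "K \<subseteq> offsets i y" "\<forall>i\<in>D - {l}. y' i = y i" "y l < y' l"
    and rank: "rank i K y + j * s ^ card D \<le> rank i K y'"
  shows "\<exists>w. (\<forall>i\<in>D - {l}. w i div s = y i) \<and> w i mod s = \<kappa> \<and>
    j \<le> card {v \<in> line D l light w. y l \<le> v div s \<and> v div s < y' l}"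
proof (rule ccontr)
  assume contra: "\<not> ?thesis"
  let ?R = "\<lambda>z. {y' \<in> chunks. K \<subseteq> offsets i y' \<and> (\<forall>i\<in>D - {l}. y' i = z i) \<and> y' l < z l}"
  \<comment> \<open>\<open>V\<close> contains \<open>y\<close> but not \<open>y'\<close>, so it is
    exactly what \<open>rank\<close> counts additionally at \<open>y'\<close>.\<close>
  define V where "V = {z \<in> chunks. K \<subseteq> offsets i z \<and> (\<forall>i\<in>D - {l}. z i = y i) \<and> y l \<le> z l \<and> z l < y' l}"
  have "?R y' = ?R y \<union> V" using y(4,5) by (auto simp: V_def)
  then have "rank i K y' \<le> rank i K y + card V" unfolding rank_def by (simp add: card_Un_le)
  then have card_V: "j * s ^ card D \<le> card V" using rank by simp
  have "\<exists>x. z \<in> V \<longrightarrow> x \<in> light \<and> key x = z \<and> x i mod s = \<kappa>" for z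
    using \<kappa> by (auto simp: V_def offsets_def fiber_def)
  then obtain f where f: "\<And>z. z \<in> V \<Longrightarrow> f z \<in> light \<and> key (f z) = z \<and> f z i mod s = \<kappa>"
    using choice[of "\<lambda>z x. z \<in> V \<longrightarrow> x \<in> light \<and> key x = z \<and> x i mod s = \<kappa>"] by blast
  have "inj_on f V" using f by (metis inj_onI)
  have fin_V: "finite V" using finite_chunks by (auto simp: V_def)
  obtain x' where x': "key x' = y'" using y(2) by (auto simp: chunks_def)
  define \<rho> where "\<rho> = restrict y (D - {l})"
  have row_x': "row x' = \<rho>" unfolding \<rho>_def using x' y(4) by (auto intro!: row_eqI)
  \<comment> \<open>A chunk starting before \<open>y' l\<close> also ends before it, since
    \<open>y' l\<close> is the start of its own chunk and \<open>chunk_start\<close> is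
    monotone.\<close>
  have bounds: "y l \<le> f z l div s" "f z l div s < y' l" if z: "z \<in> V" for z
  proof -
    have row: "row (f z) = \<rho>" unfolding \<rho>_def using f[OF z] z by (intro row_eqI) (auto simp: V_def)
    have zl: "z l = chunk_start (full \<rho>) (f z l div s)" using f[OF z] row key_l by metis
    have yl: "y' l = chunk_start (full \<rho>) (x' l div s)" using x' row_x' key_l by metis
    have "y l \<le> z l" "z l < y' l" using z by (auto simp: V_def)
    then show "y l \<le> f z l div s" using chunk_start_le[of "full \<rho>" "f z l div s"] zl by simp
    show "f z l div s < y' l"
    proof (rule ccontr)
      assume "\<not> ?thesis"
      then have "chunk_start (full \<rho>) (y' l) \<le> z l" unfolding zl by (intro chunk_start_mono) simp
      moreover have "chunk_start (full \<rho>) (y' l) = y' l" unfolding yl by (rule chunk_start_idem)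
      ultimately show False using \<open>z l < y' l\<close> by simp
    qed
  qed
  let ?P = "Pi\<^sub>E (D - {l}) (\<lambda>i. {y i * s..<y i * s + s})"
  have "card (f ` V) \<le> (j - 1) * card ?P"
  proof (rule card_le_mult_fibers[where f = "\<lambda>x. restrict x (D - {l})"])
    show "finite (f ` V)" using fin_V by simp
    show "finite ?P" using fin_D by (intro finite_PiE) auto
    show "(\<lambda>x. restrict x (D - {l})) ` f ` V \<subseteq> ?P"
    proof (rule image_subsetI)
      fix x assume "x \<in> f ` V"
      then obtain z where z: "z \<in> V" "x = f z" by auto
      have "x i' \<in> {y i' * s..<y i' * s + s}" if i': "i' \<in> D - {l}" for i'
      proof -
        have "y i' = x i' div s" using f[OF z(1)] z key_other[OF i', of x] i' by (auto simp: V_def)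
        then show ?thesis using s by (auto intro!: less_div_mult_add)
      qed
      then show "restrict x (D - {l}) \<in> ?P" by (simp add: restrict_PiE_iff)
    qed
    fix r assume r: "r \<in> ?P"
    define A where "A = {x \<in> f ` V. restrict x (D - {l}) = r}"
    show "card {x \<in> f ` V. restrict x (D - {l}) = r} \<le> j - 1"
    proof (cases "A = {}")
      case True then show ?thesis by (simp only: A_def[symmetric] card.empty)
    next
      case False
      then obtain z0 where z0: "z0 \<in> V" "restrict (f z0) (D - {l}) = r" by (auto simp: A_def)
      have rz: "r i' = f z0 i'" if "i' \<in> D - {l}" for i' using restrict_eqD[OF z0(2) that] by (rule sym)
      have r1: "\<forall>i\<in>D - {l}. r i div s = y i"
      proof
        fix i' assume i': "i' \<in> D - {l}"
        show "r i' div s = y i'"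
          using rz[OF i'] f[OF z0(1)] key_other[OF i', of "f z0"] z0(1) i' by (auto simp: V_def)
      qed
      have r2: "r i mod s = \<kappa>" using rz[OF i] f[OF z0(1)] by simp
      have "\<not> j \<le> card {v \<in> line D l light r. y l \<le> v div s \<and> v div s < y' l}"
        using contra r1 r2 by blast
      moreover have "card A \<le> card {v \<in> line D l light r. y l \<le> v div s \<and> v div s < y' l}"
      proof (rule card_inj_on_le)
        show "inj_on (\<lambda>x. x l) A"
        proof (rule inj_onI)
          fix x x' assume x: "x \<in> A" "x' \<in> A" "x l = x' l"
          have A: "z \<in> D \<rightarrow>\<^sub>E {..<s * n}" "restrict z (D - {l}) = r" if "z \<in> A" for z
            using that X light_subset f by (auto simp: A_def)
          have "restrict x (D - {l}) = restrict x' (D - {l})" using A(2)[OF x(1)] A(2)[OF x(2)] by (rule trans[OF _ sym])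
          then show "x = x'" using x(3) by (rule PiE_eqI[OF A(1)[OF x(1)] A(1)[OF x(2)]])
        qed
        show "(\<lambda>x. x l) ` A \<subseteq> {v \<in> line D l light r. y l \<le> v div s \<and> v div s < y' l}"
        proof (rule image_subsetI)
          fix x assume "x \<in> A"
          then obtain z where z: "z \<in> V" "x = f z" "restrict x (D - {l}) = r" by (auto simp: A_def)
          then have "\<forall>i'\<in>D - {l}. x i' = r i'" using restrict_eqD by metis
          then have "x l \<in> line D l light r" unfolding line_def using f[OF z(1)] z(2) by blast
          then show "x l \<in> {v \<in> line D l light r. y l \<le> v div s \<and> v div s < y' l}"
            using bounds[OF z(1)] z(2) by simp
        qed
        show "finite {v \<in> line D l light r. y l \<le> v div s \<and> v div s < y' l}"
          using finite_line[OF finite_light] by simp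
      qed
      ultimately show ?thesis by (simp add: A_def)
    qed
  qed
  also have "card ?P = s ^ (card D - 1)" using fin_D l by (simp add: card_PiE)
  also have "(j - 1) * s ^ (card D - 1) \<le> (j - 1) * s ^ card D"
    using s by (intro mult_left_mono power_increasing) auto
  also have "\<dots> < j * s ^ card D" using s j by simp
  finally show False using card_V card_image[OF \<open>inj_on f V\<close>] by simp
qed

text \<open>A wide chunk is labelled by a \<open>k\<close>-element set \<open>K\<close> of its
  offsets and by its rank modulo \<open>N\<close>. In a copy of the pattern with coordinate
  \<open>i\<close> deleted inside one class, the extreme chunks of each tuple have different but
  congruent ranks, so between them there is a line with \<open>j\<close> points at any wanted offset
  from \<open>K\<close>. Taking for index \<open>t\<close> the offset at position
  \<open>\<pi> i t\<close> in sorted \<open>K\<close> restores coordinate \<open>i\<close>.\<close>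

lemma card_wide_le:
  assumes i: "i \<in> D - {l}"
  shows "card (wide i) \<le> n * (2 ^ s * (j * s ^ card D)) * B"
proof -
  define N where "N = j * s ^ card D"
  have N: "N > 0" using j s by (simp add: N_def)
  define Q where "Q y m \<longleftrightarrow> card (fst m) = k \<and> fst m \<subseteq> offsets i y \<and> rank i (fst m) y mod N = snd m"
    for y :: "nat \<Rightarrow> nat" and m :: "nat set \<times> nat"
  have iD: "i \<in> D" using i by simp
  have li: "l \<in> D - {i}" using i l by auto
  have "card (wide i) \<le> n * card (Pow {..<s} \<times> {..<N}) * B"
  proof (rule card_le_slices[OF fin_D iD, where Q = Q])
    show sub: "wide i \<subseteq> D \<rightarrow>\<^sub>E {..<n}" using chunks_subset by (auto simp: wide_def)
    show "finite (Pow {..<s} \<times> {..<N})" by simp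
    fix y assume "y \<in> wide i"
    then have "k \<le> card (offsets i y)" by (simp add: wide_def)
    then obtain K where K: "K \<subseteq> offsets i y" "card K = k" by (meson obtain_subset_with_card_n)
    then have "Q y (K, rank i K y mod N)" by (simp add: Q_def)
    moreover have "K \<in> Pow {..<s}" using K offsets_subset[of i y] by blast
    ultimately show "\<exists>m\<in>Pow {..<s} \<times> {..<N}. Q y m" using N by (meson SigmaI lessThan_iff mod_less_divisor)
  next
    fix c m assume c: "c < n" and "m \<in> Pow {..<s} \<times> {..<N}"
    obtain K r where m: "m = (K, r)" by (cases m)
    define Z where "Z = (\<lambda>z. restrict z (D - {i})) ` {z \<in> wide i. z i = c \<and> Q z m}"
    have "{z \<in> wide i. z i = c \<and> Q z m} \<subseteq> D \<rightarrow>\<^sub>E {..<n}"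
      using chunks_subset by (auto simp: wide_def)
    from restrict_image_subset_PiE[OF this Diff_subset]
    have "Z \<subseteq> (D - {i}) \<rightarrow>\<^sub>E {..<n}" unfolding Z_def .
    moreover have "\<not> has_pattern (D - {i}) l j k \<pi> Z"
    proof
      assume "has_pattern (D - {i}) l j k \<pi> Z"
      then obtain u T where T: "pattern_at (D - {i}) l j k \<pi> Z u T" by (auto simp: has_pattern_def)
      note T = pattern_atD[OF T]
      have fin_T: "finite (T t)" "T t \<noteq> {}" if "t < k" for t
        using T(2)[OF that] j by (auto intro: card_ge_0_finite)
      let ?e = "\<lambda>t. sorted_list_of_set K ! \<pi> i t"
      have ex: "\<exists>w. t < k \<longrightarrow> card K = k \<and> (\<forall>i'\<in>D - {l}. w i' div s = (if i' = i then c else u t i')) \<and>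
          w i mod s = ?e t \<and>
          j \<le> card {v \<in> line D l light w. Min (T t) \<le> v div s \<and> v div s < Max (T t)}" for t
      proof (cases "t < k")
        case True
        note fin = fin_T[OF True]
        have "\<not> is_singleton (T t)" using T(2)[OF True] j by (auto simp: is_singleton_altdef)
        then have less: "Min (T t) < Max (T t)"
          using fin by (metis Max_ge Min_in Min_le is_singletonI' le_antisym not_le order_trans)
        have lift: "\<exists>y\<in>chunks. y l = v \<and> y i = c \<and> (\<forall>i'\<in>D - {l} - {i}. y i' = u t i') \<and> Q y m"
          if v: "v \<in> T t" for v
        proof -
          obtain z where z: "z \<in> Z" "z l = v" "\<forall>i'\<in>D - {i} - {l}. z i' = u t i'"
            using T(1)[OF True] v by (auto simp: line_def)
          then obtain y where y: "y \<in> wide i" "z = restrict y (D - {i})" "y i = c" "Q y m"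
            by (auto simp: Z_def)
          have "y l = v" using z(2) y(2) li by auto
          moreover have "\<forall>i'\<in>D - {l} - {i}. y i' = u t i'" using z(3) y(2) by auto
          moreover have "y \<in> chunks" using y(1) by (simp add: wide_def)
          ultimately show ?thesis using y by blast
        qed
        obtain y where y: "y \<in> chunks" "y l = Min (T t)" "y i = c" "\<forall>i'\<in>D - {l} - {i}. y i' = u t i'" "Q y m"
          using lift[OF Min_in[OF fin]] by blast
        obtain y' where y': "y' \<in> chunks" "y' l = Max (T t)" "y' i = c" "\<forall>i'\<in>D - {l} - {i}. y' i' = u t i'" "Q y' m"
          using lift[OF Max_in[OF fin]] by blast
        have K: "K \<subseteq> offsets i y" "card K = k" "rank i K y mod N = rank i K y' mod N"
          using y(5) y'(5) by (auto simp: Q_def m)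
        have same: "\<forall>i'\<in>D - {l}. y' i' = y i'"
        proof
          fix i' assume "i' \<in> D - {l}"
          then show "y' i' = y i'" using y(3,4) y'(3,4) by (cases "i' = i") auto
        qed
        have fin_K: "finite K" using K k by (auto intro: card_ge_0_finite)
        then have "?e t \<in> K" using \<pi>[OF iD True] K(2)
          by (metis nth_mem set_sorted_list_of_set sorted_list_of_set.length_sorted_key_list_of_set)
        \<comment> \<open>\<open>y\<close> is counted in the rank of \<open>y'\<close> but not in
          its own; with equal residues the ranks then differ by at least \<open>N\<close>.\<close>
        moreover have "rank i K y < rank i K y'"
          unfolding rank_def
        proof (rule psubset_card_mono)
          show "finite {y'' \<in> chunks. K \<subseteq> offsets i y'' \<and> (\<forall>i\<in>D - {l}. y'' i = y' i) \<and> y'' l < y' l}"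
            using finite_chunks by simp
          have "y \<in> {y'' \<in> chunks. K \<subseteq> offsets i y'' \<and> (\<forall>i\<in>D - {l}. y'' i = y' i) \<and> y'' l < y' l}"
            using y(1,2) y'(2) K(1) same less by simp
          moreover have "y \<notin> {y'' \<in> chunks. K \<subseteq> offsets i y'' \<and> (\<forall>i\<in>D - {l}. y'' i = y i) \<and> y'' l < y l}"
            by simp
          moreover have "{y'' \<in> chunks. K \<subseteq> offsets i y'' \<and> (\<forall>i\<in>D - {l}. y'' i = y i) \<and> y'' l < y l}
            \<subseteq> {y'' \<in> chunks. K \<subseteq> offsets i y'' \<and> (\<forall>i\<in>D - {l}. y'' i = y' i) \<and> y'' l < y' l}"
            using same y(2) y'(2) less by auto
          ultimately show "{y'' \<in> chunks. K \<subseteq> offsets i y'' \<and> (\<forall>i\<in>D - {l}. y'' i = y i) \<and> y'' l < y l}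
            \<subset> {y'' \<in> chunks. K \<subseteq> offsets i y'' \<and> (\<forall>i\<in>D - {l}. y'' i = y' i) \<and> y'' l < y' l}"
            by blast
        qed
        then have "rank i K y + N \<le> rank i K y'"
          using K(3) by (rule add_le_if_mod_eq)
        ultimately have "\<exists>w. (\<forall>i\<in>D - {l}. w i div s = y i) \<and> w i mod s = ?e t \<and>
            j \<le> card {v \<in> line D l light w. y l \<le> v div s \<and> v div s < y' l}"
          using many_wide_chunks_give_lines[OF i _ y(1) y'(1) K(1) same] less y(2) y'(2) unfolding N_def by simp
        then obtain w where w: "\<forall>i\<in>D - {l}. w i div s = y i" "w i mod s = ?e t"
            "j \<le> card {v \<in> line D l light w. y l \<le> v div s \<and> v div s < y' l}" by blast
        have "\<forall>i'\<in>D - {l}. w i' div s = (if i' = i then c else u t i')"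
          using w(1) y(3,4) by auto
        then show ?thesis using w(2,3) K(2) unfolding y(2) y'(2) by (intro exI[of _ w] impI conjI)
      qed auto
      from choice[OF allI[OF ex]] obtain W where "\<forall>t. t < k \<longrightarrow> card K = k \<and>
          (\<forall>i'\<in>D - {l}. W t i' div s = (if i' = i then c else u t i')) \<and> W t i mod s = ?e t \<and>
          j \<le> card {v \<in> line D l light (W t). Min (T t) \<le> v div s \<and> v div s < Max (T t)}" ..
      note W = this[THEN spec, THEN mp]
      have "has_pattern D l j k \<pi> light"
      proof (rule has_patternI[of k j D l light W "\<lambda>t v. Min (T t) \<le> v div s \<and> v div s < Max (T t)"])
        show "j \<le> card {v \<in> line D l light (W t). Min (T t) \<le> v div s \<and> v div s < Max (T t)}" if "t < k" for t
          using W[OF that] by blast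
      next
        fix i' t t' assume i': "i' \<in> D - {l}" and t: "t < k" "t' < k" "\<pi> i' t < \<pi> i' t'"
        \<comment> \<open>In direction \<open>i\<close> all cubes have index \<open>c\<close>, so
          the order is decided by the offsets \<open>?e\<close>; in the other directions it is
          decided by the cube indices.\<close>
        show "W t i' < W t' i'"
        proof (cases "i' = i")
          case True
          have "?e t < ?e t'" using W[OF t(1)] \<pi>[OF iD t(2)] t(3) True
            by (intro sorted_list_of_set_nth_less) auto
          then have "W t i mod s < W t' i mod s" "W t i div s = W t' i div s"
            using W[OF t(1)] W[OF t(2)] i by auto
          then show ?thesis unfolding True by (metis add_less_cancel_left div_mult_mod_eq)
        next
          case False
          then have "u t i' < u t' i'" using T(3)[OF _ t] i' by simp
          then have "W t i' div s < W t' i' div s"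
            using W[OF t(1)] W[OF t(2)] i' False by simp
          then show ?thesis by (rule less_if_div_less)
        qed
      next
        fix t t' v v' assume t: "t < k" "t' < k" "\<pi> l t < \<pi> l t'"
          and v: "Min (T t) \<le> v div s \<and> v div s < Max (T t)" "Min (T t') \<le> v' div s \<and> v' div s < Max (T t')"
        have "Max (T t) < Min (T t')"
          using T(4)[OF t Max_in[OF fin_T[OF t(1)]] Min_in[OF fin_T[OF t(2)]]] .
        then have "v div s < v' div s" using v by simp
        then show "v < v'" by (rule less_if_div_less)
      qed
      then show False using avoids has_pattern_mono light_subset by blast
    qed
    ultimately show "card ((\<lambda>z. restrict z (D - {i})) ` {z \<in> wide i. z i = c \<and> Q z m}) \<le> B"
      using lower_dim[OF iD li] unfolding Z_def by blast
  qed
  then show ?thesis by (simp add: card_Pow N_def card_cartesian_product)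
qed

section \<open>The recursive inequality\<close>

lemma card_light_le:
  "card light \<le> 2 * j * k * k ^ (card D - 1) * card chunks +
     2 * j * k * s ^ (card D - 1) * (\<Sum>i\<in>D - {l}. card (wide i))"
proof -
  let ?W = "\<Union>i\<in>D - {l}. wide i"
  let ?X1 = "{x \<in> light. key x \<notin> ?W}" and ?X2 = "{x \<in> light. key x \<in> ?W}"
  \<comment> \<open>Chunks that are wide in no direction have fewer than \<open>k\<close> values in
    each coordinate other than \<open>l\<close>.\<close>
  have "card ?X1 \<le> 2 * j * k * k ^ (card D - 1) * card chunks"
  proof (rule card_le_mult_fibers[where f = key])
    fix y assume y: "y \<in> chunks"
    show "card {x \<in> ?X1. key x = y} \<le> 2 * j * k * k ^ (card D - 1)"
    proof (cases "y \<in> ?W")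
      case True
      then have "{x \<in> ?X1. key x = y} = {}" by blast
      then show ?thesis by (simp only: card.empty)
    next
      case False
      have "card ((\<lambda>x. x i) ` fiber y) \<le> k" if i: "i \<in> D - {l}" for i
      proof -
        have "y \<notin> wide i" using False i by blast
        then show ?thesis using y card_coord_image[OF i, of y] by (simp add: wide_def)
      qed
      then have "card (fiber y) \<le> 2 * j * k * k ^ (card D - 1)" by (rule card_fiber_le)
      moreover have "card {x \<in> ?X1. key x = y} \<le> card (fiber y)"
        using finite_light by (intro card_mono) (auto simp: fiber_def)
      ultimately show ?thesis by linarith
    qed
  qed (use finite_light finite_chunks in \<open>auto simp: chunks_def\<close>)
  \<comment> \<open>For the remaining chunks the trivial bound of \<open>s\<close> values per
    coordinate is enough, as \<open>card_wide_le\<close> makes them few.\<close>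
  moreover have "card ?X2 \<le> 2 * j * k * s ^ (card D - 1) * card ?W"
  proof (rule card_le_mult_fibers[where f = key])
    show "finite ?W" using fin_D finite_chunks by (auto simp: wide_def)
    fix y
    have "card ((\<lambda>x. x i) ` fiber y) \<le> s" if "i \<in> D - {l}" for i
      using card_coord_image[OF that, of y] card_mono[OF _ offsets_subset[of i y]] by simp
    then have "card (fiber y) \<le> 2 * j * k * s ^ (card D - 1)" by (rule card_fiber_le)
    moreover have "card {x \<in> ?X2. key x = y} \<le> card (fiber y)"
      using finite_light by (intro card_mono) (auto simp: fiber_def)
    ultimately show "card {x \<in> ?X2. key x = y} \<le> 2 * j * k * s ^ (card D - 1)" by linarith
  qed (use finite_light in auto)
  moreover have "card ?W \<le> (\<Sum>i\<in>D - {l}. card (wide i))" using fin_D by (intro card_UN_le) auto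
  moreover have "card light \<le> card ?X1 + card ?X2"
  proof -
    have "light = ?X1 \<union> ?X2" by blast
    then show ?thesis using card_Un_le[of ?X1 ?X2] by simp
  qed
  ultimately show ?thesis by (meson add_mono mult_le_mono2 order_trans)
qed

text \<open>The coefficient of \<open>card chunks\<close> is free of \<open>s\<close>. The
  coefficients that grow with \<open>s\<close> meet only \<open>n * B\<close>, the contribution of
  heavy cubes and wide chunks, which rests on the bound in one dimension less.\<close>

lemma contraction_bound:
  "card X \<le> 2 * j * k ^ card D * card chunks +
     (s ^ card D * 2 ^ s + 2 * j * k * s ^ (card D - 1) * (card D - 1) * (2 ^ s * (j * s ^ card D))) * (n * B)"
proof -
  have "(\<Sum>i\<in>D - {l}. card (wide i)) \<le> card (D - {l}) * (n * (2 ^ s * (j * s ^ card D)) * B)"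
    using sum_bounded_above[of "D - {l}" "\<lambda>i. card (wide i)"] card_wide_le by simp
  also have "card (D - {l}) = card D - 1" using fin_D l by simp
  finally have "2 * j * k * s ^ (card D - 1) * (\<Sum>i\<in>D - {l}. card (wide i)) \<le>
     2 * j * k * s ^ (card D - 1) * ((card D - 1) * (n * (2 ^ s * (j * s ^ card D)) * B))"
    by (rule mult_le_mono2)
  moreover have "s ^ card D * card heavy_blocks \<le> s ^ card D * (n * 2 ^ s * B)" using card_heavy_blocks_le by (rule mult_le_mono2)
  moreover have eq: "2 * j * k * k ^ (card D - 1) = 2 * j * k ^ card D"
    using card_D by (cases "card D") auto
  ultimately have "card X \<le> 2 * j * k ^ card D * card chunks +
      2 * j * k * s ^ (card D - 1) * ((card D - 1) * (n * (2 ^ s * (j * s ^ card D)) * B)) +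
      s ^ card D * (n * 2 ^ s * B)"
    using card_X_le card_light_le[unfolded eq] by linarith
  then show ?thesis by (simp only: distrib_left distrib_right ac_simps)
qed

end

subsection \<open>The upper bound for point sets\<close>

text \<open>The exponent \<open>m\<close> is the dimension minus one. \<open>D\<close> ranges over
  all coordinate sets of that dimension, so that the statement applies after any coordinate is
  deleted, and \<open>C\<close> is uniform in \<open>D\<close>, \<open>l\<close>,
  \<open>\<pi>\<close> and \<open>n\<close>.\<close>

definition pattern_bound :: "nat \<Rightarrow> nat \<Rightarrow> nat \<Rightarrow> nat \<Rightarrow> bool" where
  "pattern_bound j k m C \<longleftrightarrow>
     (\<forall>D l \<pi> n X. card D = Suc m \<longrightarrow> l \<in> D \<longrightarrow> (\<forall>i\<in>D. \<forall>t<k. \<pi> i t < k) \<longrightarrow>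
        X \<subseteq> D \<rightarrow>\<^sub>E {..<n} \<longrightarrow> \<not> has_pattern D l j k \<pi> X \<longrightarrow> card X \<le> C * n ^ m)"

lemma pattern_boundD:
  assumes "pattern_bound j k m C" "card D = Suc m" "l \<in> D" "\<And>i t. i \<in> D \<Longrightarrow> t < k \<Longrightarrow> \<pi> i t < k"
    "X \<subseteq> D \<rightarrow>\<^sub>E {..<n}" "\<not> has_pattern D l j k \<pi> X"
  shows "card X \<le> C * n ^ m"
  using assms unfolding pattern_bound_def by blast

text \<open>In dimension one there is a single line, and \<open>j * k\<close> points on it already
  split into \<open>k\<close> consecutive tuples.\<close>

lemma pattern_bound_0: "pattern_bound j k 0 (j * k)"
  unfolding pattern_bound_def
proof (intro allI impI)
  fix D :: "nat set" and l n :: nat and \<pi> X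
  assume D: "card D = Suc 0" "l \<in> D" and \<pi>: "\<forall>i\<in>D. \<forall>t<k. \<pi> i t < k"
    and X: "X \<subseteq> D \<rightarrow>\<^sub>E {..<n}" and avoids: "\<not> has_pattern D l j k \<pi> X"
  have D_l: "D - {l} = {}" using D by (metis Diff_cancel card_1_singletonE One_nat_def singletonD)
  show "card X \<le> j * k * n ^ 0"
  proof (rule ccontr)
    assume big: "\<not> ?thesis"
    have "inj_on (\<lambda>x. x l) X"
    proof (rule inj_onI)
      fix x x' assume x: "x \<in> X" "x' \<in> X" "x l = x' l"
      have "x \<in> D \<rightarrow>\<^sub>E {..<n}" "x' \<in> D \<rightarrow>\<^sub>E {..<n}" using X x by blast+
      then show "x = x'" by (rule PiE_eqI[where i = l]) (simp_all add: D_l x(3) restrict_def)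
    qed
    then have "j * k \<le> card ((\<lambda>x. x l) ` X)" using big by (simp add: card_image)
    moreover have "\<pi> l t < k" if "t < k" for t using \<pi> D(2) that by blast
    ultimately have "\<exists>S. (\<forall>t<k. S t \<subseteq> (\<lambda>x. x l) ` X \<and> card (S t) = j) \<and>
        (\<forall>t<k. \<forall>t'<k. \<pi> l t < \<pi> l t' \<longrightarrow> (\<forall>v\<in>S t. \<forall>v'\<in>S t'. v < v'))"
      by (rule split_into_consecutive)
    then obtain S where S: "(\<forall>t<k. S t \<subseteq> (\<lambda>x. x l) ` X \<and> card (S t) = j) \<and>
        (\<forall>t<k. \<forall>t'<k. \<pi> l t < \<pi> l t' \<longrightarrow> (\<forall>v\<in>S t. \<forall>v'\<in>S t'. v < v'))" ..
    have line: "line D l X u = (\<lambda>x. x l) ` X" for u by (auto simp: line_def D_l)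
    have "has_pattern D l j k \<pi> X"
    proof (rule has_patternI[of k j D l X "\<lambda>_ _. 0" "\<lambda>t v. v \<in> S t"])
      fix t assume t: "t < k"
      have "{v \<in> line D l X (\<lambda>_. 0). v \<in> S t} = S t" using S t unfolding line by blast
      then show "j \<le> card {v \<in> line D l X (\<lambda>_. 0). v \<in> S t}" using S t by simp
    next
      fix t t' v v' assume "t < k" "t' < k" "\<pi> l t < \<pi> l t'" "v \<in> S t" "v' \<in> S t'"
      then show "v < v'" using S by blast
    qed (simp add: D_l)
    then show False using avoids by simp
  qed
qed

text \<open>Strong induction on the side length: cutting into cubes of side \<open>s\<close> gives
  \<open>card X \<le> q * card chunks + G * C0 * n' ^ Suc m\<close> with \<open>n'\<close> about
  \<open>n / s\<close>. As \<open>q\<close> does not depend on \<open>s\<close>, a large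
  \<open>s\<close> makes the first term at most half of \<open>C * n ^ Suc m\<close>.\<close>

lemma pattern_bound_Suc:
  assumes j: "j \<ge> 2" and k: "k \<ge> 1" and C0: "pattern_bound j k m C0"
  shows "\<exists>C. pattern_bound j k (Suc m) C"
proof -
  define d where "d = Suc (Suc m)"
  define q where "q = 2 * j * k ^ d"
  \<comment> \<open>For \<open>n \<ge> s\<close> the new side \<open>n'\<close> satisfies
    \<open>s * n' \<le> 2 * n\<close>, so the factor 4 yields
    \<open>2 * q * n' \<le> n\<close>.\<close>
  define s where "s = 4 * q"
  define G where "G = s ^ d * 2 ^ s + 2 * j * k * s ^ (d - 1) * (d - 1) * (2 ^ s * (j * s ^ d))"
  \<comment> \<open>The summand \<open>s\<close> pays for the trivial bound when
    \<open>n < s\<close>, and \<open>G * C0\<close> for the second term of the recursion.\<close>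
  define C where "C = s + G * C0"
  have q: "q \<ge> 1" using j k by (simp add: q_def)
  have "pattern_bound j k (Suc m) C"
    unfolding pattern_bound_def
  proof (intro allI impI)
    fix D :: "nat set" and l n :: nat and \<pi> X
    assume D: "card D = Suc (Suc m)" "l \<in> D" and \<pi>: "\<forall>i\<in>D. \<forall>t<k. \<pi> i t < k"
      and "X \<subseteq> D \<rightarrow>\<^sub>E {..<n}" "\<not> has_pattern D l j k \<pi> X"
    have fin_D: "finite D" using D(1) by (auto intro: card_ge_0_finite)
    from \<open>X \<subseteq> D \<rightarrow>\<^sub>E {..<n}\<close> \<open>\<not> has_pattern D l j k \<pi> X\<close> show "card X \<le> C * n ^ Suc m"
    proof (induction n arbitrary: X rule: less_induct)
      case (less n X)
      show ?case
      proof (cases "n < s")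
        case True
        have "card X \<le> card (D \<rightarrow>\<^sub>E {..<n})" using less.prems(1) fin_D
          by (intro card_mono finite_PiE) auto
        also have "\<dots> = n * n ^ Suc m" using fin_D D(1) by (simp add: card_PiE)
        also have "\<dots> \<le> C * n ^ Suc m" using True by (intro mult_le_mono1) (simp add: C_def)
        finally show ?thesis .
      next
        case False
        define n' where "n' = n div s + 1"
        have s: "s > 0" using q by (simp add: s_def)
        have "n < s * n'" using s less_div_mult_add[of s n] by (simp add: n'_def algebra_simps)
        have "s * n' \<le> n + s" by (simp add: n'_def)
        then have qn: "2 * q * n' \<le> n" using False by (simp add: s_def)
        moreover have "n' \<le> q * n'" using q by simp
        moreover have "n' > 0" by (simp add: n'_def)
        ultimately have "n' < n" by linarith
        interpret contraction D l s n' j k \<pi> X "C0 * n' ^ m"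
        proof
          have "D \<rightarrow>\<^sub>E {..<n} \<subseteq> D \<rightarrow>\<^sub>E {..<s * n'}" using \<open>n < s * n'\<close> by (intro PiE_mono) auto
          then show "X \<subseteq> D \<rightarrow>\<^sub>E {..<s * n'}" using less.prems(1) by (rule order_trans[rotated])
          show "card Z \<le> C0 * n' ^ m" if "i \<in> D" "l' \<in> D - {i}" "Z \<subseteq> D - {i} \<rightarrow>\<^sub>E {..<n'}"
            "\<not> has_pattern (D - {i}) l' j k \<pi> Z" for i l' Z
            using that D(1) fin_D \<pi> by (intro pattern_boundD[OF C0]) auto
        qed (use fin_D D s j k \<pi> less.prems in auto)
        have "card chunks \<le> C * n' ^ Suc m" using \<open>n' < n\<close> chunks_subset chunks_avoids by (rule less.IH)
        then have chunks: "q * card chunks \<le> q * (C * n' ^ Suc m)" by (rule mult_le_mono2)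
        have X: "card X \<le> q * card chunks + G * (n' * (C0 * n' ^ m))"
          using contraction_bound unfolding q_def G_def d_def D(1) .
        \<comment> \<open>As the exponent is positive, raising \<open>2 * q * n' \<le> n\<close> to
          it still leaves one factor \<open>2 * q\<close> on the left.\<close>
        have "2 * q \<le> (2 * q) ^ Suc m" using q by simp
        then have "2 * q * n' ^ Suc m \<le> (2 * q * n') ^ Suc m"
          unfolding power_mult_distrib by (rule mult_le_mono1)
        also have "\<dots> \<le> n ^ Suc m" using qn by (intro power_mono) auto
        finally have qn': "2 * q * n' ^ Suc m \<le> n ^ Suc m" .
        have "2 * card X \<le> 2 * (q * (C * n' ^ Suc m) + G * (n' * (C0 * n' ^ m)))"
          by (rule mult_le_mono2[OF order_trans[OF X add_right_mono[OF chunks]]])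
        also have "\<dots> = C * (2 * q * n' ^ Suc m) + G * C0 * (2 * n' ^ Suc m)"
          by (simp add: algebra_simps)
        also have "\<dots> \<le> C * n ^ Suc m + C * n ^ Suc m"
        proof (intro add_mono mult_le_mono)
          have "2 * n' ^ Suc m \<le> 2 * q * n' ^ Suc m" using q by simp
          then show "2 * n' ^ Suc m \<le> n ^ Suc m" using qn' by linarith
        qed (use qn' in \<open>simp_all add: C_def\<close>)
        finally show ?thesis by simp
      qed
    qed
  qed
  then show ?thesis ..
qed

lemma ex_pattern_bound: "j \<ge> 2 \<Longrightarrow> k \<ge> 1 \<Longrightarrow> \<exists>C. pattern_bound j k m C"
  by (induction m) (use pattern_bound_0 pattern_bound_Suc in blast)+

subsection \<open>Matrices as point sets\<close>

lemma sorted_list_of_set_nth_mem: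
  fixes S :: "nat set"
  assumes "p < card S"
  shows "sorted_list_of_set S ! p \<in> S"
proof -
  have "finite S" using assms by (auto intro: card_ge_0_finite)
  moreover have "p < length (sorted_list_of_set S)" using assms by simp
  ultimately show ?thesis using nth_mem set_sorted_list_of_set by blast
qed

lemma card_less_sorted_list_of_set_nth:
  fixes S :: "nat set"
  assumes "p < card S"
  shows "card {x \<in> S. x < sorted_list_of_set S ! p} = p"
proof -
  let ?e = "\<lambda>q. sorted_list_of_set S ! q"
  have "finite S" using assms by (auto intro: card_ge_0_finite)
  have "{x \<in> S. x < ?e p} = ?e ` {..<p}"
  proof
    show "?e ` {..<p} \<subseteq> {x \<in> S. x < ?e p}"
      using assms by (auto intro!: sorted_list_of_set_nth_less sorted_list_of_set_nth_mem)
    show "{x \<in> S. x < ?e p} \<subseteq> ?e ` {..<p}"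
    proof
      fix x assume x: "x \<in> {x \<in> S. x < ?e p}"
      then have "x \<in> set (sorted_list_of_set S)" using \<open>finite S\<close> by simp
      then obtain q where q: "q < card S" "x = ?e q" by (auto simp: in_set_conv_nth)
      have "q < p"
      proof (rule ccontr)
        assume "\<not> q < p"
        then have "p = q \<or> p < q" by auto
        then have "?e p \<le> ?e q" using sorted_list_of_set_nth_less[of p q S] q(1) by auto
        then show False using x q(2) by simp
      qed
      then show "x \<in> ?e ` {..<p}" using q by blast
    qed
  qed
  moreover have "inj_on ?e {..<p}"
    using assms by (intro inj_on_nth) auto
  ultimately show ?thesis by (simp add: card_image)
qed

text \<open>The element of rank \<open>p\<close> lies in the set whose position is
  \<open>p div w\<close>: below it are all sets of smaller position, with \<open>w\<close> elements
  each, and fewer than \<open>w\<close> elements of its own set. This matches the rule by which a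
  Kronecker product addresses its blocks.\<close>

lemma union_of_consecutive:
  fixes V :: "nat \<Rightarrow> nat set"
  assumes \<sigma>: "bij_betw \<sigma> {..<k} {..<k}" and w: "w > 0" and V: "\<And>t. t < k \<Longrightarrow> card (V t) = w"
    and less: "\<And>t t' v v'. t < k \<Longrightarrow> t' < k \<Longrightarrow> \<sigma> t < \<sigma> t' \<Longrightarrow> v \<in> V t \<Longrightarrow> v' \<in> V t' \<Longrightarrow> v < v'"
  shows card_union_of_consecutive: "card (\<Union>t<k. V t) = k * w"
    and nth_union_of_consecutive: "p < k * w \<Longrightarrow> t < k \<Longrightarrow> \<sigma> t = p div w \<Longrightarrow>
      sorted_list_of_set (\<Union>t<k. V t) ! p \<in> V t"
proof -
  have inj: "\<sigma> t = \<sigma> t' \<longleftrightarrow> t = t'" if "t < k" "t' < k" for t t'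
    using \<sigma> that by (auto simp: bij_betw_def inj_on_def)
  have fin: "finite (V t)" if "t < k" for t
    using V[OF that] w by (auto intro: card_ge_0_finite)
  have disj: "V t \<inter> V t' = {}" if t: "t < k" "t' < k" "t \<noteq> t'" for t t'
  proof -
    have "\<sigma> t < \<sigma> t' \<or> \<sigma> t' < \<sigma> t" using inj[OF t(1,2)] t(3) by linarith
    then have "v \<notin> V t'" if "v \<in> V t" for v
      using less[OF t(1,2) _ that, of v] less[OF t(2,1) _ _ that, of v] by auto
    then show ?thesis by blast
  qed
  show card: "card (\<Union>t<k. V t) = k * w"
    using fin disj V by (subst card_UN_disjoint) auto
  assume p: "p < k * w" and t: "t < k" "\<sigma> t = p div w"
  define e where "e = sorted_list_of_set (\<Union>t<k. V t) ! p"
  have "e \<in> (\<Union>t<k. V t)" unfolding e_def using p card by (intro sorted_list_of_set_nth_mem) simp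
  then obtain t' where t': "t' < k" "e \<in> V t'" by blast
  define I where "I = {t''. t'' < k \<and> \<sigma> t'' < \<sigma> t'}"
  define R where "R = {x \<in> V t'. x < e}"
  have "{x \<in> (\<Union>t<k. V t). x < e} = (\<Union>t\<in>I. V t) \<union> R"
  proof (intro equalityI subsetI)
    fix x assume "x \<in> {x \<in> (\<Union>t<k. V t). x < e}"
    then obtain t'' where t'': "t'' < k" "x \<in> V t''" "x < e" by blast
    have "\<not> \<sigma> t' < \<sigma> t''" using less[OF t'(1) t''(1) _ t'(2) t''(2)] t''(3) by auto
    then consider "t'' = t'" | "\<sigma> t'' < \<sigma> t'" using inj[OF t''(1) t'(1)] by linarith
    then show "x \<in> (\<Union>t\<in>I. V t) \<union> R" by cases (use t'' in \<open>auto simp: I_def R_def\<close>)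
  next
    fix x assume "x \<in> (\<Union>t\<in>I. V t) \<union> R"
    then show "x \<in> {x \<in> (\<Union>t<k. V t). x < e}"
    proof
      assume "x \<in> (\<Union>t\<in>I. V t)"
      then obtain t'' where t'': "t'' < k" "\<sigma> t'' < \<sigma> t'" "x \<in> V t''" by (auto simp: I_def)
      then have "x < e" using less[OF t''(1) t'(1) t''(2,3) t'(2)] by simp
      then show ?thesis using t'' by blast
    qed (use t' in \<open>auto simp: R_def\<close>)
  qed
  moreover have "card {x \<in> (\<Union>t<k. V t). x < e} = p"
    unfolding e_def using p card by (intro card_less_sorted_list_of_set_nth) simp
  moreover have "card ((\<Union>t\<in>I. V t) \<union> R) = card (\<Union>t\<in>I. V t) + card R"
  proof (rule card_Un_disjoint)
    show "finite (\<Union>t\<in>I. V t)" "finite R" using fin t' by (auto simp: I_def R_def)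
    have "V t'' \<inter> R = {}" if "t'' \<in> I" for t''
      using disj[of t'' t'] that t'(1) by (auto simp: I_def R_def)
    then show "(\<Union>t\<in>I. V t) \<inter> R = {}" by blast
  qed
  moreover have "card (\<Union>t\<in>I. V t) = card I * w"
    using fin disj V by (subst card_UN_disjoint) (auto simp: I_def)
  moreover have "card I = \<sigma> t'"
  proof -
    have "\<sigma> t' < k" using \<sigma> t'(1) by (auto simp: bij_betw_def)
    have "\<sigma> ` I = {..<\<sigma> t'}"
    proof (intro equalityI subsetI)
      fix c assume c: "c \<in> {..<\<sigma> t'}"
      then have "c \<in> \<sigma> ` {..<k}" using \<sigma> \<open>\<sigma> t' < k\<close> by (simp add: bij_betw_def)
      then show "c \<in> \<sigma> ` I" using c by (auto simp: I_def)
    qed (auto simp: I_def)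
    moreover have "inj_on \<sigma> I" using \<sigma> by (auto simp: I_def bij_betw_def inj_on_def)
    ultimately show ?thesis using card_image[of \<sigma> I] by simp
  qed
  moreover have "card R < w"
  proof -
    have "R \<subset> V t'" using t'(2) by (auto simp: R_def)
    then show ?thesis using psubset_card_mono[OF fin[OF t'(1)]] V[OF t'(1)] by metis
  qed
  ultimately have "p = \<sigma> t' * w + card R" "card R < w" by simp_all
  then have "p div w = \<sigma> t'" by simp
  then have "t = t'" using inj[OF t(1) t'(1)] t(2) by simp
  then show "sorted_list_of_set (\<Union>t<k. V t) ! p \<in> V t" using t'(2) e_def by simp
qed

section \<open>Index sets and permutation matrices\<close>

lemma indices_iff: "x \<in> indices ns \<longleftrightarrow> length x = length ns \<and> (\<forall>l<length ns. x ! l < ns ! l)"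
  by (simp add: indices_def)

lemma indices_replicate_eq: "indices (replicate d n) = {x. set x \<subseteq> {..<n} \<and> length x = d}"
  by (auto simp: indices_def set_conv_nth)

lemma finite_indices: "finite (indices ns)"
proof (rule finite_subset)
  have "x ! l < Suc (sum_list ns)" if "x \<in> indices ns" "l < length ns" for x l
    using that elem_le_sum_list[of l ns]
    by (auto simp: indices_def less_Suc_eq_le intro: order.strict_implies_order order_trans)
  then show "indices ns \<subseteq> {x. set x \<subseteq> {..<Suc (sum_list ns)} \<and> length x = length ns}"
    by (auto simp: indices_iff set_conv_nth)
  show "finite {x. set x \<subseteq> {..<Suc (sum_list ns)} \<and> length x = length ns}"
    by (intro finite_lists_length_eq) simp
qed

lemma finite_zero_one_matrices: "finite {A. zero_one_matrix A \<and> dims A = ns}"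
proof (rule finite_subset)
  show "{A. zero_one_matrix A \<and> dims A = ns} \<subseteq> Array ns ` (indices ns \<rightarrow>\<^sub>E {0, 1})"
  proof
    fix A assume "A \<in> {A. zero_one_matrix A \<and> dims A = ns}"
    then show "A \<in> Array ns ` (indices ns \<rightarrow>\<^sub>E {0, 1})"
      by (intro image_eqI[of _ _ "entry A"]) (auto simp: zero_one_matrix_def)
  qed
  show "finite (Array ns ` (indices ns \<rightarrow>\<^sub>E {0, 1}))"
    using finite_indices by (intro finite_imageI finite_PiE) auto
qed

lemma zero_one_matrix_cases: "zero_one_matrix A \<Longrightarrow> x \<in> indices (dims A) \<Longrightarrow> entry A x = 0 \<or> entry A x = 1"
  unfolding zero_one_matrix_def by (drule PiE_mem) auto

lemma select_in_indices:
  assumes "length Ss = length ns" "\<forall>l<length Ss. Ss ! l \<subseteq> {..<ns ! l}" "y \<in> indices (map card Ss)"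
  shows "map2 (\<lambda>S i. sorted_list_of_set S ! i) Ss y \<in> indices ns"
proof -
  have "sorted_list_of_set (Ss ! l) ! (y ! l) < ns ! l" if "l < length Ss" for l
  proof -
    have "y ! l < card (Ss ! l)" using assms(3) that by (auto simp: indices_iff)
    then show ?thesis using sorted_list_of_set_nth_mem assms(2) that by blast
  qed
  then show ?thesis using assms(1,3) by (simp add: indices_iff)
qed

text \<open>The ones are numbered by coordinate 0. Two ones that share some coordinate lie in one
  cross section and coincide, so each coordinate is an injective, hence bijective, function of the
  number.\<close>

lemma permutation_matrix_positions:
  assumes P: "permutation_matrix d k P" and d: "d \<ge> 1"
  obtains \<pi> where "\<And>i. i < d \<Longrightarrow> bij_betw (\<pi> i) {..<k} {..<k}"
    "\<And>x. x \<in> indices (replicate d k) \<Longrightarrow> entry P x = 1 \<longleftrightarrow> (\<exists>t<k. \<forall>i<d. x ! i = \<pi> i t)"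
proof -
  have dims: "dims P = replicate d k" and zo: "zero_one_matrix P"
    using P by (auto simp: permutation_matrix_def)
  have uniq: "\<exists>!x. x \<in> cross_section P i c \<and> entry P x \<noteq> 0" if "i < d" "c < k" for i c
    using P that by (auto simp: permutation_matrix_def)
  define p where "p t = (THE x. x \<in> cross_section P 0 t \<and> entry P x \<noteq> 0)" for t
  have p: "p t \<in> indices (replicate d k)" "p t ! 0 = t" "entry P (p t) \<noteq> 0" if "t < k" for t
    using theI'[OF uniq[of 0 t]] d that by (auto simp: p_def cross_section_def dims)
  have p_less: "p t ! i < k" if "t < k" "i < d" for t i
    using p(1)[OF that(1)] that(2) by (simp add: indices_iff)
  have p_unique: "x = p t"
    if "x \<in> indices (replicate d k)" "entry P x \<noteq> 0" "i < d" "t < k" "x ! i = p t ! i" for x t i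
  proof -
    have "x \<in> cross_section P i (p t ! i)" "p t \<in> cross_section P i (p t ! i)"
      using that p(1)[OF that(4)] by (auto simp: cross_section_def dims)
    then show ?thesis using uniq[OF that(3) p_less[OF that(4,3)]] that(2) p(3)[OF that(4)] by blast
  qed
  show ?thesis
  proof (rule that[of "\<lambda>i t. p t ! i"])
    fix i assume i: "i < d"
    have "inj_on (\<lambda>t. p t ! i) {..<k}"
    proof (rule inj_onI)
      fix t t' assume t: "t \<in> {..<k}" "t' \<in> {..<k}" "p t ! i = p t' ! i"
      then have "p t = p t'" using p_unique[OF p(1,3) i] by simp
      then show "t = t'" using p(2) t by (metis lessThan_iff)
    qed
    moreover have "(\<lambda>t. p t ! i) ` {..<k} \<subseteq> {..<k}" using p_less i by auto
    ultimately show "bij_betw (\<lambda>t. p t ! i) {..<k} {..<k}"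
      using endo_inj_surj[of "{..<k}"] by (simp add: bij_betw_def)
  next
    fix x assume x: "x \<in> indices (replicate d k)"
    show "entry P x = 1 \<longleftrightarrow> (\<exists>t<k. \<forall>i<d. x ! i = p t ! i)"
    proof
      assume "entry P x = 1"
      have "x ! 0 < k" using x d by (simp add: indices_iff)
      then have "x = p (x ! 0)" using p_unique[OF x, of 0 "x ! 0"] \<open>entry P x = 1\<close> d p(2) by simp
      then show "\<exists>t<k. \<forall>i<d. x ! i = p t ! i" using \<open>x ! 0 < k\<close> by metis
    next
      assume "\<exists>t<k. \<forall>i<d. x ! i = p t ! i"
      then obtain t where t: "t < k" "\<forall>i<d. x ! i = p t ! i" by blast
      have "x = p t" using x p(1)[OF t(1)] t(2) by (intro nth_equalityI) (auto simp: indices_iff)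
      then show "entry P x = 1" using p(3)[OF t(1)] zero_one_matrix_cases[OF zo, of x] x by (simp add: dims)
    qed
  qed
qed

section \<open>Tuple permutation matrices as patterns\<close>

locale tuple_permutation =
  fixes P :: multi_array and d k j l :: nat and \<pi> :: "nat \<Rightarrow> nat \<Rightarrow> nat"
  assumes P: "permutation_matrix d k P" and l: "l < d" and j: "j \<ge> 2"
    and \<pi>: "\<And>i. i < d \<Longrightarrow> bij_betw (\<pi> i) {..<k} {..<k}"
    and entry_P: "\<And>x. x \<in> indices (replicate d k) \<Longrightarrow>
      entry P x = 1 \<longleftrightarrow> (\<exists>t<k. \<forall>i<d. x ! i = \<pi> i t)"
begin

definition width :: "nat \<Rightarrow> nat" where "width i = (if i = l then j else 1)"

definition M :: multi_array where "M = kronecker P (all_ones ((replicate d 1)[l := j]))"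

lemma width_pos: "width i > 0" using j by (simp add: width_def)

lemma widths: "(replicate d 1)[l := j] = map width [0..<d]"
  using l by (intro nth_equalityI) (auto simp: width_def nth_list_update)

lemma dims_P: "dims P = replicate d k" using P by (simp add: permutation_matrix_def)

lemma dims_M: "dims M = map (\<lambda>i. k * width i) [0..<d]"
  unfolding M_def widths kronecker_def all_ones_def dims_P multi_array.sel
  by (intro nth_equalityI) auto

lemma entry_M:
  assumes y: "y \<in> indices (dims M)"
  shows "entry M y = (if \<exists>t<k. \<forall>i<d. y ! i div width i = \<pi> i t then 1 else 0)"
proof -
  have y': "length y = d" "\<And>i. i < d \<Longrightarrow> y ! i < k * width i" using y by (auto simp: indices_iff dims_M)
  let ?ks = "map width [0..<d]"
  have "y \<in> indices (map2 (*) (replicate d k) ?ks)" using y' by (simp add: indices_iff)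
  moreover have "map2 (mod) y ?ks \<in> indices ?ks" using y' width_pos by (simp add: indices_iff)
  moreover have "map2 (div) y ?ks \<in> indices (replicate d k)"
    using y' by (simp add: indices_iff less_mult_imp_div_less)
  from entry_P[OF this]
  have "entry P (map2 (div) y ?ks) = 1 \<longleftrightarrow> (\<exists>t<k. \<forall>i<d. y ! i div width i = \<pi> i t)"
    using y'(1) by simp
  ultimately show ?thesis unfolding M_def widths kronecker_def all_ones_def dims_P by simp
qed

definition points :: "multi_array \<Rightarrow> (nat \<Rightarrow> nat) set" where
  "points A = (\<lambda>x. \<lambda>i\<in>{..<d}. x ! i) ` {x \<in> indices (dims A). entry A x = 1}"

lemma points_subset: "dims A = replicate d n \<Longrightarrow> points A \<subseteq> {..<d} \<rightarrow>\<^sub>E {..<n}"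
  unfolding points_def by (rule image_subsetI) (simp add: restrict_PiE_iff indices_iff)

lemma card_points: "dims A = replicate d n \<Longrightarrow> card (points A) = num_ones A"
proof -
  assume dims: "dims A = replicate d n"
  have "inj_on (\<lambda>x. \<lambda>i\<in>{..<d}. x ! i) {x \<in> indices (dims A). entry A x = 1}"
  proof (rule inj_onI)
    fix x y :: "nat list" assume x: "x \<in> {x \<in> indices (dims A). entry A x = 1}"
      "y \<in> {x \<in> indices (dims A). entry A x = 1}" and eq: "(\<lambda>i\<in>{..<d}. x ! i) = (\<lambda>i\<in>{..<d}. y ! i)"
    show "x = y"
    proof (rule nth_equalityI)
      show "length x = length y" using x by (simp add: indices_iff)
      fix i assume "i < length x"
      then have "i < d" using x by (simp add: indices_iff dims)
      then show "x ! i = y ! i" using fun_cong[OF eq, of i] by simp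
    qed
  qed
  then show ?thesis by (simp add: points_def num_ones_def card_image)
qed

text \<open>The selected values of coordinate \<open>i\<close> are the union over \<open>t\<close>
  of \<open>V i t\<close>, which is \<open>T t\<close> in direction \<open>l\<close> and the single
  value \<open>u t i\<close> otherwise. By \<open>nth_union_of_consecutive\<close>, an index of
  \<open>M\<close> in the block of the \<open>t\<close>-th one selects a value from
  \<open>V i t\<close> in every coordinate, hence a one of \<open>A\<close>.\<close>

lemma contains_if_has_pattern:
  assumes zo: "zero_one_matrix A" and dims_A: "dims A = replicate d n"
    and pat: "has_pattern {..<d} l j k \<pi> (points A)"
  shows "contains A M"
proof -
  obtain u T where "pattern_at {..<d} l j k \<pi> (points A) u T" using pat by (auto simp: has_pattern_def)
  note T = pattern_atD[OF this]
  define V where "V i t = (if i = l then T t else {u t i})" for i t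
  define S where "S i = (\<Union>t<k. V i t)" for i
  define Ss where "Ss = map S [0..<d]"
  have card_V: "card (V i t) = width i" if "t < k" for i t
    using T(2)[OF that] by (simp add: V_def width_def)
  have V_less: "v < v'"
    if "i < d" "t < k" "t' < k" "\<pi> i t < \<pi> i t'" "v \<in> V i t" "v' \<in> V i t'" for i t t' v v'
  proof (cases "i = l")
    case True
    then show ?thesis using T(4)[OF that(2,3)] that(4-6) by (simp add: V_def)
  next
    case False
    then show ?thesis using T(3)[OF _ that(2-4)] that(1,5,6) by (simp add: V_def)
  qed
  note card_S = card_union_of_consecutive[OF \<pi> width_pos card_V V_less]
  note nth_S = nth_union_of_consecutive[OF \<pi> width_pos card_V V_less]
  have point: "\<exists>x. x \<in> indices (dims A) \<and> entry A x = 1 \<and> x ! l = v \<and> (\<forall>i<d. i \<noteq> l \<longrightarrow> x ! i = u t i)"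
    if t: "t < k" and v: "v \<in> T t" for t v
  proof -
    have "v \<in> line {..<d} l (points A) (u t)" using T(1)[OF t] v by blast
    then obtain f where f: "f \<in> points A" "f l = v" "\<forall>i\<in>{..<d} - {l}. f i = u t i"
      unfolding line_def by blast
    then obtain x where "x \<in> indices (dims A)" "entry A x = 1" "f = (\<lambda>i\<in>{..<d}. x ! i)"
      unfolding points_def by blast
    then show ?thesis using f l by (intro exI[of _ x]) auto
  qed
  have V_subset: "V i t \<subseteq> {..<n}" if "i < d" "t < k" for i t
  proof -
    \<comment> \<open>A point on the \<open>t\<close>-th line, available since \<open>j\<close> is
      positive, shows that \<open>u t i\<close> is in range.\<close>
    have "T t \<noteq> {}" using T(2)[OF that(2)] j by auto
    then obtain v0 where v0: "v0 \<in> T t" by blast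
    have "v < n" if v: "v \<in> V i t" for v
    proof (cases "i = l")
      case True
      then have "v \<in> T t" using v by (simp add: V_def)
      then obtain x where "x \<in> indices (dims A)" "x ! l = v" using point[OF \<open>t < k\<close>] by blast
      then show ?thesis using l by (auto simp: indices_iff dims_A)
    next
      case False
      then have "v = u t i" using v by (simp add: V_def)
      moreover obtain x where "x \<in> indices (dims A)" "x ! i = u t i"
        using point[OF \<open>t < k\<close> v0] False \<open>i < d\<close> by blast
      ultimately show ?thesis using \<open>i < d\<close> by (auto simp: indices_iff dims_A)
    qed
    then show ?thesis by blast
  qed
  have Ss_subset: "\<forall>i<length Ss. Ss ! i \<subseteq> {..<dims A ! i}"
    using V_subset by (auto simp: Ss_def S_def dims_A)
  have dims_Ss: "map card Ss = dims M"
    using card_S by (auto simp: Ss_def S_def dims_M)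
  have len: "length Ss = length (dims A)" by (simp add: Ss_def dims_A)
  have "\<forall>y\<in>indices (dims M). entry M y = entry (submatrix A Ss) y \<or>
      entry (submatrix A Ss) y = 1 \<and> entry M y = 0"
  proof
    fix y assume y: "y \<in> indices (dims M)"
    define z where "z = map2 (\<lambda>S i. sorted_list_of_set S ! i) Ss y"
    have z: "z \<in> indices (dims A)"
      unfolding z_def by (rule select_in_indices[OF len Ss_subset]) (simp add: dims_Ss y)
    have entry_C: "entry (submatrix A Ss) y = entry A z"
      using y by (simp add: submatrix_def dims_Ss z_def)
    have y': "length y = d" "\<And>i. i < d \<Longrightarrow> y ! i < k * width i" using y by (auto simp: indices_iff dims_M)
    have z_nth: "z ! i = sorted_list_of_set (S i) ! (y ! i)" if "i < d" for i
      using that y'(1) by (simp add: z_def Ss_def)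
    have "entry A z = 1" if "entry M y = 1"
    proof -
      obtain t where t: "t < k" "\<forall>i<d. y ! i div width i = \<pi> i t"
        using \<open>entry M y = 1\<close> unfolding entry_M[OF y] by (metis zero_neq_one)
      have zV: "z ! i \<in> V i t" if "i < d" for i
        unfolding z_nth[OF that] S_def using t y'(2)[OF that] that
        by (intro nth_S) auto
      have "z ! l \<in> T t" using zV[OF l] by (simp add: V_def)
      then obtain x where x: "x \<in> indices (dims A)" "entry A x = 1" "x ! l = z ! l"
          "\<forall>i<d. i \<noteq> l \<longrightarrow> x ! i = u t i"
        using point[OF t(1)] by blast
      have "x = z"
      proof (rule nth_equalityI)
        show "length x = length z" using x(1) z by (simp add: indices_iff)
        fix i assume "i < length x"
        then have i: "i < d" using x(1) by (simp add: indices_iff dims_A)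
        show "x ! i = z ! i" using x(3,4) zV[OF i] i by (cases "i = l") (auto simp: V_def)
      qed
      then show ?thesis using x(2) by simp
    qed
    moreover have "entry M y = 0 \<or> entry M y = 1" by (simp add: entry_M[OF y])
    moreover have "entry A z = 0 \<or> entry A z = 1" using zero_one_matrix_cases[OF zo z] .
    ultimately show "entry M y = entry (submatrix A Ss) y \<or>
      entry (submatrix A Ss) y = 1 \<and> entry M y = 0" unfolding entry_C by auto
  qed
  moreover have "is_submatrix_of (submatrix A Ss) A"
    unfolding is_submatrix_of_def using len Ss_subset by blast
  moreover have "dims (submatrix A Ss) = dims M" by (simp add: submatrix_def dims_Ss)
  ultimately show ?thesis unfolding contains_def by blast
qed

section \<open>The all-ones cross section\<close>

definition section_matrix :: "nat \<Rightarrow> multi_array" where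
  "section_matrix n = Array (replicate d n) (\<lambda>x\<in>indices (replicate d n). if x ! l = 0 then 1 else 0)"

text \<open>In a copy of \<open>M\<close>, a one with \<open>l\<close>-th index 1 would be sent to
  the second smallest selected value of coordinate \<open>l\<close>, which is positive, whereas all
  ones of the matrix have \<open>l\<close>-th coordinate 0.\<close>

lemma section_matrix_avoids:
  assumes k: "k \<ge> 1"
  shows "\<not> contains (section_matrix n) M"
proof
  let ?A = "section_matrix n"
  assume "contains ?A M"
  then obtain Ss where Ss: "length Ss = length (dims ?A)" "\<forall>l<length Ss. Ss ! l \<subseteq> {..<dims ?A ! l}"
    and dims: "map card Ss = dims M"
    and C: "\<forall>y\<in>indices (dims M). entry M y = entry (submatrix ?A Ss) y \<or>
      entry (submatrix ?A Ss) y = 1 \<and> entry M y = 0"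
    by (auto simp: contains_def is_submatrix_of_def submatrix_def)
  have "0 \<in> \<pi> l ` {..<k}" using \<pi>[OF l] k by (simp add: bij_betw_def)
  then obtain t where t: "t < k" "\<pi> l t = 0" by auto
  \<comment> \<open>The summand 1 picks the second entry of the tuple at position 0 in direction
    \<open>l\<close>; \<open>j \<ge> 2\<close> keeps it inside the block.\<close>
  define y where "y = map (\<lambda>i. \<pi> i t * width i + (if i = l then 1 else 0)) [0..<d]"
  have \<pi>_less: "\<pi> i t < k" if "i < d" for i using \<pi>[OF that] t(1) by (auto simp: bij_betw_def)
  have y_nth: "y ! i = \<pi> i t * width i + (if i = l then 1 else 0)" if "i < d" for i
    using that by (simp add: y_def)
  have div: "y ! i div width i = \<pi> i t" if "i < d" for i
    using y_nth[OF that] j by (auto simp: width_def)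
  have "y ! i < k * width i" if "i < d" for i
    using div[OF that] \<pi>_less[OF that] width_pos[of i] div_less_iff_less_mult by metis
  then have y: "y \<in> indices (dims M)" by (simp add: indices_iff dims_M y_def)
  have "entry M y = 1" using entry_M[OF y] div t(1) by auto
  then have "entry (submatrix ?A Ss) y = 1" using C y by auto
  define z where "z = map2 (\<lambda>S i. sorted_list_of_set S ! i) Ss y"
  have z: "z \<in> indices (dims ?A)"
    unfolding z_def by (rule select_in_indices[OF Ss]) (simp add: dims y)
  have "entry ?A z = 1"
    using \<open>entry (submatrix ?A Ss) y = 1\<close> y by (simp add: submatrix_def dims z_def)
  then have "z ! l = 0" using z by (auto simp: section_matrix_def split: if_splits)
  have len: "length Ss = d" using Ss(1) by (simp add: section_matrix_def)
  have "card (Ss ! l) = dims M ! l" using dims len l by (metis nth_map)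
  then have card: "card (Ss ! l) = k * j" using l by (simp add: dims_M width_def)
  have "1 < card (Ss ! l)" using k j unfolding card
    by (metis One_nat_def Suc_1 Suc_le_lessD less_le_trans mult.commute mult_le_mono nat_mult_1_right)
  then have "sorted_list_of_set (Ss ! l) ! 0 < sorted_list_of_set (Ss ! l) ! 1"
    by (intro sorted_list_of_set_nth_less) auto
  moreover have "z ! l = sorted_list_of_set (Ss ! l) ! 1"
    using len l y_nth[OF l] t(2) by (simp add: z_def y_def)
  ultimately show False using \<open>z ! l = 0\<close> by simp
qed

lemma section_matrix_props: "zero_one_matrix (section_matrix n)" "dims (section_matrix n) = replicate d n"
  by (auto simp: zero_one_matrix_def section_matrix_def)

lemma num_ones_section_matrix:
  assumes "l = 0" "n > 0"
  shows "n ^ (d - 1) \<le> num_ones (section_matrix n)"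
proof -
  have "Cons 0 ` indices (replicate (d - 1) n) \<subseteq>
    {x \<in> indices (dims (section_matrix n)). entry (section_matrix n) x = 1}"
    unfolding section_matrix_def multi_array.sel indices_replicate_eq using assms l by auto
  then have "card (Cons 0 ` indices (replicate (d - 1) n)) \<le> num_ones (section_matrix n)"
    unfolding num_ones_def using finite_indices by (intro card_mono) auto
  moreover have "card (Cons 0 ` indices (replicate (d - 1) n)) = n ^ (d - 1)"
    using card_lists_length_eq[of "{..<n}" "d - 1"] by (simp add: card_image indices_replicate_eq)
  ultimately show ?thesis by simp
qed

lemma finite_avoiders: "finite {A. zero_one_matrix A \<and> dims A = replicate d n \<and> \<not> contains A M}"
  by (rule finite_subset[OF _ finite_zero_one_matrices[of "replicate d n"]]) auto

lemma ex_ones_le: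
  assumes k: "k \<ge> 1" and C: "pattern_bound j k (d - 1) C"
  shows "ex_ones n M d \<le> C * n ^ (d - 1)"
proof -
  let ?S = "{A. zero_one_matrix A \<and> dims A = replicate d n \<and> \<not> contains A M}"
  \<comment> \<open>This makes the set nonempty, so that its maximum is attained by a
    member.\<close>
  have "section_matrix n \<in> ?S" using section_matrix_avoids[OF k] section_matrix_props by blast
  then have "?S \<noteq> {}" by blast
  moreover have "num_ones A \<le> C * n ^ (d - 1)" if A: "A \<in> ?S" for A
  proof -
    have "\<not> has_pattern {..<d} l j k \<pi> (points A)" using contains_if_has_pattern A by blast
    moreover have "\<pi> i t < k" if "i \<in> {..<d}" "t < k" for i t
      using \<pi>[of i] that by (auto simp: bij_betw_def)
    moreover have "points A \<subseteq> {..<d} \<rightarrow>\<^sub>E {..<n}" using A points_subset by blast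
    ultimately have "card (points A) \<le> C * n ^ (d - 1)"
      using l by (intro pattern_boundD[OF C, of "{..<d}" l \<pi>]) auto
    moreover have "card (points A) = num_ones A" using A by (intro card_points[of _ n]) simp
    ultimately show ?thesis by simp
  qed
  ultimately show ?thesis unfolding ex_ones_def using finite_avoiders[of n] by (subst Max_le_iff) auto
qed

lemma ex_ones_ge:
  assumes "k \<ge> 1" "l = 0" "n > 0"
  shows "n ^ (d - 1) \<le> ex_ones n M d"
proof -
  have "num_ones (section_matrix n) \<le> ex_ones n M d"
    unfolding ex_ones_def
    using section_matrix_avoids[OF assms(1)] section_matrix_props finite_avoiders[of n]
    by (intro Max_ge) auto
  then show ?thesis using num_ones_section_matrix[OF assms(2,3)] by simp
qed

end

section \<open>Asymptotics of the maximum\<close>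

lemma obtain_tuple_permutation:
  assumes "permutation_matrix d k P" "l < d" "j \<ge> 2"
  obtains \<pi> where "tuple_permutation P d k j l \<pi>"
proof -
  have d: "d \<ge> 1" using assms(2) by simp
  show ?thesis
    by (rule permutation_matrix_positions[OF assms(1) d])
      (rule that, rule tuple_permutation.intro, use assms in auto)
qed

text \<open>An explicit permutation matrix: it makes the maximum in
  \<open>ex_tuple_permutation\<close> range over a nonempty set and carries the lower bound.\<close>

definition diagonal_matrix :: "nat \<Rightarrow> nat \<Rightarrow> multi_array" where
  "diagonal_matrix d k = Array (replicate d k)
     (\<lambda>x\<in>indices (replicate d k). if x = replicate d (x ! 0) then 1 else 0)"

lemma permutation_matrix_diagonal:
  assumes "d \<ge> 1"
  shows "permutation_matrix d k (diagonal_matrix d k)"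
  unfolding permutation_matrix_def
proof (intro conjI allI impI)
  fix l c assume lc: "l < d" "c < k"
  show "\<exists>!x. x \<in> cross_section (diagonal_matrix d k) l c \<and> entry (diagonal_matrix d k) x \<noteq> 0"
  proof (rule ex1I[of _ "replicate d c"])
    show "replicate d c \<in> cross_section (diagonal_matrix d k) l c \<and>
        entry (diagonal_matrix d k) (replicate d c) \<noteq> 0"
      using lc by (auto simp: cross_section_def diagonal_matrix_def indices_def)
    fix x assume x: "x \<in> cross_section (diagonal_matrix d k) l c \<and> entry (diagonal_matrix d k) x \<noteq> 0"
    then have "x = replicate d (x ! 0)" "x ! l = c"
      by (auto simp: cross_section_def diagonal_matrix_def split: if_splits)
    then show "x = replicate d c" using lc by (metis nth_replicate)
  qed
qed (auto simp: diagonal_matrix_def zero_one_matrix_def)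

lemma finite_tuple_permutation_matrices: "finite (tuple_permutation_matrices j k d)"
proof (rule finite_subset)
  let ?P = "{P. zero_one_matrix P \<and> dims P = replicate d k}"
  show "tuple_permutation_matrices j k d \<subseteq>
      (\<lambda>(P, l). kronecker P (all_ones ((replicate d 1)[l := j]))) ` (?P \<times> {..<d})"
    by (auto simp: tuple_permutation_matrices_def permutation_matrix_def)
  show "finite ((\<lambda>(P, l). kronecker P (all_ones ((replicate d 1)[l := j]))) ` (?P \<times> {..<d}))"
    using finite_zero_one_matrices by blast
qed

theorem theorem3p1:
  fixes d k j :: nat
  assumes "d \<ge> 1" and "k \<ge> 1" and "j \<ge> 2"
  shows "(\<lambda>n. real (ex_tuple_permutation n j k d)) \<in> \<Theta>(\<lambda>n. real n ^ (d - 1))"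
proof -
  let ?M = "tuple_permutation_matrices j k d"
  obtain C where C: "pattern_bound j k (d - 1) C" using ex_pattern_bound assms by blast
  obtain \<pi>0 where "tuple_permutation (diagonal_matrix d k) d k j 0 \<pi>0"
    using obtain_tuple_permutation[OF permutation_matrix_diagonal] assms by (metis Suc_le_lessD One_nat_def)
  then interpret diag: tuple_permutation "diagonal_matrix d k" d k j 0 \<pi>0 .
  have diag_M: "diag.M \<in> ?M"
    unfolding diag.M_def tuple_permutation_matrices_def
    using permutation_matrix_diagonal assms(1) by (intro CollectI exI conjI) auto
  have lower: "n ^ (d - 1) \<le> ex_tuple_permutation n j k d" if "n > 0" for n
  proof -
    have "ex_ones n diag.M d \<le> ex_tuple_permutation n j k d"
      unfolding ex_tuple_permutation_def
      using finite_tuple_permutation_matrices diag_M by (intro Max_ge) auto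
    then show ?thesis using diag.ex_ones_ge[OF assms(2) refl that] by simp
  qed
  have upper: "ex_tuple_permutation n j k d \<le> C * n ^ (d - 1)" for n
  proof -
    have "ex_ones n M d \<le> C * n ^ (d - 1)" if M: "M \<in> ?M" for M
    proof -
      obtain P l where P: "permutation_matrix d k P" "l < d"
        and M_eq: "M = kronecker P (all_ones ((replicate d 1)[l := j]))"
        using M by (auto simp: tuple_permutation_matrices_def)
      obtain \<pi> where "tuple_permutation P d k j l \<pi>" using obtain_tuple_permutation[OF P assms(3)] .
      then interpret tuple_permutation P d k j l \<pi> .
      show ?thesis using ex_ones_le[OF assms(2) C, of n] unfolding M_eq M_def .
    qed
    then show ?thesis unfolding ex_tuple_permutation_def
      using finite_tuple_permutation_matrices diag_M by (subst Max_le_iff) auto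
  qed
  show ?thesis
  proof (rule bigthetaI)
    show "(\<lambda>n. real (ex_tuple_permutation n j k d)) \<in> O(\<lambda>n. real n ^ (d - 1))"
      using upper by (intro bigoI[of _ "real C"]) (auto simp flip: of_nat_power of_nat_mult)
    \<comment> \<open>The inequality is claimed for \<open>n > 0\<close> only: for
      \<open>d = 1\<close> and \<open>n = 0\<close> the comparison function is 1, while there are no
      ones.\<close>
    show "(\<lambda>n. real (ex_tuple_permutation n j k d)) \<in> \<Omega>(\<lambda>n. real n ^ (d - 1))"
      using lower
      by (intro landau_omega.bigI[of 1] eventually_mono[OF eventually_gt_at_top[of 0]])
        (auto simp flip: of_nat_power)
  qed
qed

end
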